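(* Fix an integer $d\ge 1$. There is an algorithm which, given an integer $n\ge1$, a finite bipartite $(2d,2)$-Helly graph $H$ and a graph homomorphism $f\in\mathrm{Hom}(\partial_n,H)$, decides the hole-filling problem for $f$, i.e. decides whether there exists $\tilde f\in\mathrm{Hom}(B_n,H)$ with $\tilde f|_{\partial_n}=f$, in time polynomial in $n+|H|$ (the polynomial depending only on $d$).
   Context: Graphs are nonempty, connected and simple; $H$ is presented by its adjacency matrix and $|H|$ is its number of vertices. $B_n=\{0,1,\dots,n\}^d$ is the box, viewed as an induced subgraph of the Cayley graph of $\mathbb{Z}^d$ with standard generators. $\partial_n$ is the internal vertex boundary of $B_n$: the induced subgraph on vertices of $B_n$ with at least one coordinate equal to $0$ or $n$. $\mathrm{Hom}(G,H)$ is the set of graph homomorphisms (adjacency-preserving vertex maps) from $G$ to $H$. In this statement, "bipartite $(2d,2)$-Helly graph" means: $H$ is a bipartite graph such that for all (not necessarily distinct) balls $B_1,\dots,B_{2d}$ in $H$ (closed balls of non-negative integer radius for the path metric) and each partite class $H_1$ of $H$, if $B_i\cap B_j\cap H_1\neq\varnothing$ for all $i\neq j$, then $\bigcap_{i=1}^{2d}(B_i\cap H_1)\neq\varnothing$. *)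

theory Defs
  imports "Graph_Theory.Graph_Theory" "HOL-Computational_Algebra.Polynomial"
begin

section \<open>Homomorphisms, boxes and bipartite Helly graphs\<close>

text \<open>
  A finite simple graph is a \<^locale>\<open>pair_graph\<close>: every edge is represented by its two arcs.
  The library's \<^const>\<open>connected\<close> includes nonemptiness.
\<close>

text \<open>Values outside the vertex set of the domain are unconstrained, so a function represents
  a homomorphism through its restriction to the vertices.\<close>

definition Hom :: "('a, 'c) pre_digraph \<Rightarrow> ('b, 'e) pre_digraph \<Rightarrow> ('a \<Rightarrow> 'b) set" where
  "Hom G H = {f. f ` verts G \<subseteq> verts H \<and> (\<forall>u v. u \<rightarrow>\<^bsub>G\<^esub> v \<longrightarrow> f u \<rightarrow>\<^bsub>H\<^esub> f v)}"

text \<open>The Cayley graph of \<open>\<int>\<^sup>d\<close>; its elements are the integer lists of length \<open>d\<close>.\<close>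

definition cayley_Z :: "nat \<Rightarrow> int list pair_pre_digraph" where
  "cayley_Z d = \<lparr> pverts = {x. length x = d},
     parcs = {(x, y). length x = d \<and> (\<exists>i<d. y = x[i := x ! i + 1] \<or> y = x[i := x ! i - 1])} \<rparr>"

definition box :: "nat \<Rightarrow> nat \<Rightarrow> (int list, int list \<times> int list) pre_digraph" where
  "box d n = with_proj (cayley_Z d) \<restriction> {x. length x = d \<and> set x \<subseteq> {0..int n}}"

definition box_boundary :: "nat \<Rightarrow> nat \<Rightarrow> (int list, int list \<times> int list) pre_digraph" where
  "box_boundary d n = box d n \<restriction> {x \<in> verts (box d n). \<exists>i<d. x ! i = 0 \<or> x ! i = int n}"

text \<open>The path metric is the library's shortest-path distance for unit arc costs.\<close>

definition path_dist :: "'a pair_pre_digraph \<Rightarrow> 'a \<Rightarrow> 'a \<Rightarrow> ereal" where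
  "path_dist H u v = wf_digraph.\<mu> (with_proj H) (\<lambda>_. 1) u v"

definition closed_ball :: "'a pair_pre_digraph \<Rightarrow> 'a \<Rightarrow> nat \<Rightarrow> 'a set" where
  "closed_ball H v r = {u \<in> pverts H. path_dist H v u \<le> ereal (real r)}"

definition bipartition :: "'a pair_pre_digraph \<Rightarrow> 'a set \<Rightarrow> 'a set \<Rightarrow> bool" where
  "bipartition H X Y \<longleftrightarrow> X \<union> Y = pverts H \<and> X \<inter> Y = {} \<and>
     (\<forall>(u, v) \<in> parcs H. u \<in> X \<longleftrightarrow> v \<in> Y)"

text \<open>The balls \<open>B\<^sub>1, \<dots>, B\<^sub>k\<close> are given by centres \<open>c i\<close> and radii \<open>r i\<close>, \<open>i < k\<close>.\<close>

definition bipartite_helly2 :: "nat \<Rightarrow> 'a pair_pre_digraph \<Rightarrow> bool" where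
  "bipartite_helly2 k H \<longleftrightarrow>
     (\<exists>X Y. bipartition H X Y) \<and>
     (\<forall>X Y c r. bipartition H X Y \<and> (\<forall>i<k. c i \<in> pverts H) \<and>
        (\<forall>i<k. \<forall>j<k. i \<noteq> j \<longrightarrow>
            closed_ball H (c i) (r i) \<inter> closed_ball H (c j) (r j) \<inter> X \<noteq> {}) \<longrightarrow>
        (\<Inter>i\<in>{..<k}. closed_ball H (c i) (r i) \<inter> X) \<noteq> {})"


section \<open>Algorithms and their running time\<close>

text \<open>
  The machine model is a random access machine with structured control flow.  A store consists
  of registers and of an indirectly addressable memory, both holding natural numbers.
  The only arithmetic operations are addition and truncated subtraction; in particular there is no
  multiplication.  Each operation, register or memory access, and test costs one unit.
  As a number can at most double per unit of time, all numbers occurring in a computation of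
  \<open>t\<close> units have \<open>O(t + b)\<close> bits, where \<open>b\<close> bounds the bit lengths of the input entries and
  program constants, so polynomial time on this machine is polynomial time on a Turing machine.
\<close>

type_synonym store = "(nat \<Rightarrow> nat) \<times> (nat \<Rightarrow> nat)"

datatype expr =
    Const nat
  | Reg nat
  | Mem expr
  | Plus expr expr
  | Minus expr expr

primrec eval_expr :: "expr \<Rightarrow> store \<Rightarrow> nat" where
  "eval_expr (Const k) s = k"
| "eval_expr (Reg i) s = fst s i"
| "eval_expr (Mem e) s = snd s (eval_expr e s)"
| "eval_expr (Plus e1 e2) s = eval_expr e1 s + eval_expr e2 s"
| "eval_expr (Minus e1 e2) s = eval_expr e1 s - eval_expr e2 s"

primrec cost_expr :: "expr \<Rightarrow> nat" where
  "cost_expr (Const k) = 1"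
| "cost_expr (Reg i) = 1"
| "cost_expr (Mem e) = cost_expr e + 1"
| "cost_expr (Plus e1 e2) = cost_expr e1 + cost_expr e2 + 1"
| "cost_expr (Minus e1 e2) = cost_expr e1 + cost_expr e2 + 1"

datatype prog =
    Skip
  | SetReg nat expr
  | SetMem expr expr
  | Seq prog prog
  | IfNonzero expr prog prog
  | WhileNonzero expr prog

text \<open>\<open>runs p s t s'\<close>: started in the store \<open>s\<close>, the program \<open>p\<close> halts after exactly \<open>t\<close> units
  of time in the store \<open>s'\<close>.\<close>

inductive runs :: "prog \<Rightarrow> store \<Rightarrow> nat \<Rightarrow> store \<Rightarrow> bool" where
  Skip: "runs Skip s 1 s"
| SetReg: "runs (SetReg i e) s (cost_expr e + 1) ((fst s)(i := eval_expr e s), snd s)"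
| SetMem: "runs (SetMem a e) s (cost_expr a + cost_expr e + 1)
             (fst s, (snd s)(eval_expr a s := eval_expr e s))"
| Seq: "runs p s t s' \<Longrightarrow> runs q s' t' s'' \<Longrightarrow> runs (Seq p q) s (t + t') s''"
| IfTrue: "eval_expr e s \<noteq> 0 \<Longrightarrow> runs p s t s' \<Longrightarrow>
             runs (IfNonzero e p q) s (cost_expr e + 1 + t) s'"
| IfFalse: "eval_expr e s = 0 \<Longrightarrow> runs q s t s' \<Longrightarrow>
             runs (IfNonzero e p q) s (cost_expr e + 1 + t) s'"
| WhileTrue: "eval_expr e s \<noteq> 0 \<Longrightarrow> runs p s t s' \<Longrightarrow> runs (WhileNonzero e p) s' t' s'' \<Longrightarrow>
             runs (WhileNonzero e p) s (cost_expr e + 1 + t + t') s''"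
| WhileFalse: "eval_expr e s = 0 \<Longrightarrow> runs (WhileNonzero e p) s (cost_expr e + 1) s"

inductive_cases Skip_runsE: "runs Skip s t s'"
inductive_cases SetReg_runsE: "runs (SetReg i e) s t s'"
inductive_cases SetMem_runsE: "runs (SetMem a e) s t s'"
inductive_cases Seq_runsE: "runs (Seq p q) s t s'"
inductive_cases If_runsE: "runs (IfNonzero e p q) s t s'"
inductive_cases While_runsE: "runs (WhileNonzero e p) s t s'"

lemma runs_deterministic:
  "runs p s t s' \<Longrightarrow> runs p s u s'' \<Longrightarrow> t = u \<and> s' = s''"
proof (induction arbitrary: u s'' rule: runs.induct)
  case (Skip s)
  from Skip.prems show ?case by (rule Skip_runsE) simp
next
  case (SetReg i e s)
  from SetReg.prems show ?case by (rule SetReg_runsE) simp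
next
  case (SetMem a e s)
  from SetMem.prems show ?case by (rule SetMem_runsE) simp
next
  case (Seq p s t s' q t' s2)
  obtain u1 s1 u2 where 1: "u = u1 + u2" "runs p s u1 s1" "runs q s1 u2 s''"
    by (rule Seq_runsE[OF Seq.prems])
  have 2: "t = u1 \<and> s' = s1" by (rule Seq.IH(1)[OF 1(2)])
  have "t' = u2 \<and> s2 = s''" by (rule Seq.IH(2)) (simp only: 2 1(3))
  with 1(1) 2 show ?case by simp
next
  case (IfTrue e s p t s' q)
  obtain u1 where 1: "u = cost_expr e + 1 + u1" "runs p s u1 s''"
    by (rule If_runsE[OF IfTrue.prems]) (use IfTrue.hyps in simp_all)
  from IfTrue.IH[OF 1(2)] 1(1) show ?case by simp
next
  case (IfFalse e s q t s' p)
  obtain u1 where 1: "u = cost_expr e + 1 + u1" "runs q s u1 s''"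
    by (rule If_runsE[OF IfFalse.prems]) (use IfFalse.hyps in simp_all)
  from IfFalse.IH[OF 1(2)] 1(1) show ?case by simp
next
  case (WhileTrue e s p t s' t' s2)
  obtain u1 s1 u2 where 1: "u = cost_expr e + 1 + u1 + u2" "runs p s u1 s1"
      "runs (WhileNonzero e p) s1 u2 s''"
    by (rule While_runsE[OF WhileTrue.prems]) (use WhileTrue.hyps in simp_all)
  have 2: "t = u1 \<and> s' = s1" by (rule WhileTrue.IH(1)[OF 1(2)])
  have "t' = u2 \<and> s2 = s''" by (rule WhileTrue.IH(2)) (simp only: 2 1(3))
  with 1(1) 2 show ?case by simp
next
  case (WhileFalse e s p)
  from WhileFalse.prems show ?case by (rule While_runsE) (use WhileFalse.hyps in simp_all)
qed

definition initial_store :: "nat list \<Rightarrow> store" where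
  "initial_store xs = (\<lambda>_. 0, \<lambda>a. if a < length xs then xs ! a else 0)"

text \<open>The answer of a program is read off register 0.\<close>

definition answers_within :: "prog \<Rightarrow> nat list \<Rightarrow> bool \<Rightarrow> nat \<Rightarrow> bool" where
  "answers_within p xs b T \<longleftrightarrow>
     (\<exists>t s. runs p (initial_store xs) t s \<and> t \<le> T \<and> fst s 0 = of_bool b)"

text \<open>
  An instance is presented as \<open>n\<close>, \<open>|H|\<close>, the adjacency matrix of \<open>H\<close> (row by row; the vertices
  of \<open>H\<close> are \<open>0, \<dots>, |H| - 1\<close>), and a table with one entry for each point of the box: the point
  \<open>(x\<^sub>0, \<dots>, x\<^sub>d\<^sub>-\<^sub>1)\<close> has position \<open>\<Sum>\<^sub>i x\<^sub>i (n + 1)\<^sup>i\<close> in the table.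
  The entries at points which are not on the boundary carry no information.
\<close>

definition encode_instance ::
    "nat \<Rightarrow> nat \<Rightarrow> nat pair_pre_digraph \<Rightarrow> (int list \<Rightarrow> nat) \<Rightarrow> nat list" where
  "encode_instance d n H f =
     (let m = card (pverts H) in
      [n, m] @
      [of_bool ((i, j) \<in> parcs H). i \<leftarrow> [0..<m], j \<leftarrow> [0..<m]] @
      [if x \<in> verts (box_boundary d n) then f x else 0. x \<leftarrow> List.n_lists d [0..int n]])"

end

(*
  f extends to the box iff for all boundary points x, y the graph H has a walk of length exactly
  |x - y|_1 from f x to f y.  Necessity holds because homomorphisms preserve walks.
  For sufficiency, a map f with this property on a finite subset A of Z^d is extended to one further
  point x, by induction on |A|.  For |A| <= 2d a value at x is provided by the Helly property.
  For |A| > 2d some point c of A is not strictly extremal in A in any coordinate.  If x is not c, step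
  from x towards c in one coordinate to z; by induction on |x - c|_1 the map f extends to z, and as c is
  not extremal, z lies on geodesics from x to both c and some other point of A.  So z can replace these
  two points, which makes A smaller.
  The criterion is tested for every pair of boundary points by counting walks with dynamic programming.
*)
theory Submission
  imports Defs
begin

section \<open>Extending homomorphisms\<close>

text \<open>Exact walk lengths carry distance and parity in one condition: in a bipartite graph,
  from a vertex with a neighbour there is a walk of length exactly k iff the distance is at most k
  and has the parity of k. This turns membership in balls and in a partite class, the language of
  the Helly property, into a relation that composes along lattice geodesics. The number 2d enters
  twice: as the Helly number, and as the number of ways (coordinate, direction) in which a point can
  be strictly extremal. The set A is arbitrary rather than a piece of a box, because the smaller set
  contains a point z that need not belong to A. For fixed d the test is polynomial, since there are
  at most (n + 1)^(2d) pairs, at distance at most d n. Counting walks needs only addition and a test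
  for zero; the counts can be exponentially large, but they have polynomially many bits.\<close>

lemma relpow_sym:
  assumes "sym E" "(u, v) \<in> E ^^ k" shows "(v, u) \<in> E ^^ k"
  using assms(2)
proof (induction k arbitrary: v)
  case (Suc k)
  then obtain w where "(u, w) \<in> E ^^ k" "(w, v) \<in> E" by auto
  with Suc.IH assms(1) have "(w, u) \<in> E ^^ k" "(v, w) \<in> E" by (auto dest: symD)
  then show ?case by (meson relpow_Suc_I2)
qed simp

text \<open>Crossing an edge at \<open>u\<close> back and forth prolongs a walk by 2; hence the
  demand that \<open>u\<close> have a neighbour.\<close>

lemma relpow_pad:
  assumes "sym E" "u \<in> Domain E" "(u, v) \<in> E ^^ k" "k \<le> l" "even (l - k)"
  shows "(u, v) \<in> E ^^ l"
proof -
  have "(u, v) \<in> E ^^ (k + 2 * j)" for j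
  proof (induction j)
    case (Suc j)
    obtain w where "(u, w) \<in> E" using assms(2) by auto
    with assms(1) have "(w, u) \<in> E" by (auto dest: symD)
    with \<open>(u, w) \<in> E\<close> Suc.IH have "(u, v) \<in> E ^^ Suc (Suc (k + 2 * j))"
      by (meson relpow_Suc_I2)
    then show ?case by simp
  qed (use assms(3) in simp)
  from this[of "(l - k) div 2"] assms(4,5) show ?thesis by simp
qed

text \<open>Passes the neighbour that padding needs from an old value to a newly chosen one; for
  \<open>k = 0\<close> the two coincide.\<close>

lemma relpow_Domain:
  assumes "(u, v) \<in> E ^^ k" "v \<in> Domain E" shows "u \<in> Domain E"
proof (cases k)
  case (Suc j)
  with assms(1) have "(u, v) \<in> E ^^ Suc j" by simp
  then show ?thesis by (meson relpow_Suc_D2 DomainI)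
qed (use assms in simp)

section \<open>The l1 metric on integer lists\<close>

definition l1 :: "int list \<Rightarrow> int list \<Rightarrow> nat" where
  "l1 x y = (\<Sum>i<length x. nat \<bar>x ! i - y ! i\<bar>)"

lemma l1_self [simp]: "l1 x x = 0"
  by (simp add: l1_def)

lemma l1_commute: "length x = length y \<Longrightarrow> l1 x y = l1 y x"
  by (simp add: l1_def abs_minus_commute)

lemma l1_eq_0: "length x = length y \<Longrightarrow> l1 x y = 0 \<longleftrightarrow> x = y"
  by (auto simp: l1_def list_eq_iff_nth_eq)

lemma l1_triangle:
  assumes "length y = length x" shows "l1 x z \<le> l1 x y + l1 y z"
  unfolding l1_def assms sum.distrib[symmetric] by (rule sum_mono) linarith

text \<open>In each coordinate the three distances sum to twice the largest of them.\<close>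

lemma l1_parity:
  assumes "length y = length x"
  shows "even (l1 x y + l1 x z + l1 y z)"
  unfolding l1_def assms sum.distrib[symmetric] by (rule dvd_sum) (auto simp: even_nat_iff)

text \<open>Stated additively, as subtraction on \<open>nat\<close> would truncate.\<close>

lemma l1_update:
  assumes "j < length x"
  shows "l1 (x[j := c]) y + nat \<bar>x ! j - y ! j\<bar> = l1 x y + nat \<bar>c - y ! j\<bar>"
proof -
  have *: "l1 z y = nat \<bar>z ! j - y ! j\<bar> + (\<Sum>i\<in>{..<length x} - {j}. nat \<bar>z ! i - y ! i\<bar>)"
    if "length z = length x" for z
    using assms that by (simp add: l1_def sum.remove[of _ j])
  have "(\<Sum>i\<in>{..<length x} - {j}. nat \<bar>x[j := c] ! i - y ! i\<bar>)
      = (\<Sum>i\<in>{..<length x} - {j}. nat \<bar>x ! i - y ! i\<bar>)"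
    by (rule sum.cong) auto
  with *[of x] *[of "x[j := c]"] assms show ?thesis by simp
qed

lemma l1_step:
  assumes "j < length x" "x ! j \<noteq> y ! j"
  defines "z \<equiv> x[j := x ! j + sgn (y ! j - x ! j)]"
  shows "l1 x z = 1" "l1 x y = Suc (l1 z y)"
proof -
  have "l1 z x + 0 = 1"
    using l1_update[OF assms(1), of "x ! j + sgn (y ! j - x ! j)" x] assms(2)
    by (simp add: z_def sgn_if split: if_splits)
  moreover have "length x = length z" by (simp add: z_def)
  ultimately show "l1 x z = 1" using l1_commute by fastforce
  show "l1 x y = Suc (l1 z y)"
    using l1_update[OF assms(1), of "x ! j + sgn (y ! j - x ! j)" y] assms(2)
    by (auto simp: z_def sgn_if split: if_splits)
qed

text \<open>A coordinate has at most one strict maximum and one strict minimum on \<open>A\<close>, so at most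
  \<open>2 * d\<close> points can be strictly extremal in some coordinate.\<close>

lemma exists_central_point:
  fixes A :: "'a::linorder list set"
  assumes "finite A" "card A > 2 * d"
  obtains y where "y \<in> A"
    "\<And>j. j < d \<Longrightarrow> \<exists>a\<in>A - {y}. y ! j \<le> a ! j" "\<And>j. j < d \<Longrightarrow> \<exists>a\<in>A - {y}. a ! j \<le> y ! j"
proof -
  have "\<exists>y\<in>A. \<forall>j<d. (\<exists>a\<in>A - {y}. y ! j \<le> a ! j) \<and> (\<exists>a\<in>A - {y}. a ! j \<le> y ! j)"
  proof (rule ccontr)
    assume "\<not> ?thesis"
    \<comment> \<open>The witness is a coordinate together with a side, \<open>True\<close> for a
      strict maximum; two points cannot share such a pair.\<close>
    then have "\<forall>y\<in>A. \<exists>p. fst p < d \<and> (\<forall>a\<in>A - {y}.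
        if snd p then a ! fst p < y ! fst p else y ! fst p < a ! fst p)"
      by (fastforce simp: not_le)
    then obtain p where p: "\<forall>y\<in>A. fst (p y) < d \<and> (\<forall>a\<in>A - {y}.
        if snd (p y) then a ! fst (p y) < y ! fst (p y) else y ! fst (p y) < a ! fst (p y))"
      by metis
    have "inj_on p A"
    proof (rule inj_onI, rule ccontr)
      fix y a assume "y \<in> A" "a \<in> A" "p y = p a" "y \<noteq> a"
      with p have "if snd (p y) then a ! fst (p y) < y ! fst (p y) else y ! fst (p y) < a ! fst (p y)"
        "if snd (p y) then y ! fst (p y) < a ! fst (p y) else a ! fst (p y) < y ! fst (p y)"
        by (metis DiffI singletonD)+
      then show False by (auto split: if_splits)
    qed
    moreover have "p ` A \<subseteq> {..<d} \<times> UNIV"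
    proof (rule image_subsetI)
      fix y assume "y \<in> A" with p show "p y \<in> {..<d} \<times> UNIV" by (cases "p y") force
    qed
    ultimately have "card A \<le> card ({..<d} \<times> (UNIV :: bool set))"
      by (rule card_inj_on_le) simp
    with assms(2) show False by simp
  qed
  then show thesis using that by blast
qed

section \<open>Extending walk-compatible maps point by point\<close>

text \<open>The first conjunct gives every value a neighbour, so that walks can be padded; on a
  singleton the second conjunct would not provide one.\<close>

definition walk_compatible :: "('b \<times> 'b) set \<Rightarrow> (int list \<Rightarrow> 'b) \<Rightarrow> int list set \<Rightarrow> bool" where
  "walk_compatible E f A \<longleftrightarrow>
     (\<forall>x\<in>A. f x \<in> Domain E) \<and> (\<forall>x\<in>A. \<forall>y\<in>A. (f x, f y) \<in> E ^^ l1 x y)"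

lemma walk_compatible_insert:
  assumes "sym E" "walk_compatible E f A" "A \<noteq> {}"
    and len: "\<And>y. y \<in> A \<Longrightarrow> length y = length z"
    and v: "\<And>y. y \<in> A \<Longrightarrow> (v, f y) \<in> E ^^ l1 z y"
  shows "walk_compatible E (f(z := v)) (insert z A)"
proof -
  have "v \<in> Domain E" using assms(2,3) v by (metis all_not_in_conv relpow_Domain walk_compatible_def)
  moreover have "(f y, v) \<in> E ^^ l1 y z" if "y \<in> A" for y
    using relpow_sym[OF assms(1) v[OF that]] l1_commute[OF len[OF that]] by simp
  ultimately show ?thesis using assms(2) v by (auto simp: walk_compatible_def)
qed

text \<open>The assumption \<open>base\<close> isolates the Helly property. The outer induction
  leaves \<open>f\<close> and \<open>x\<close> arbitrary, since it is applied to the map altered at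
  the auxiliary point \<open>z\<close>; the inner one keeps \<open>A\<close> and \<open>f\<close>
  and moves \<open>x\<close> towards \<open>c\<close>.\<close>

lemma walk_compatible_extend:
  assumes "sym E"
    and base: "\<And>A f x. finite A \<Longrightarrow> A \<noteq> {} \<Longrightarrow> card A \<le> 2 * d \<Longrightarrow> A \<subseteq> {x. length x = d} \<Longrightarrow>
      walk_compatible E f A \<Longrightarrow> length x = d \<Longrightarrow> \<exists>v. \<forall>y\<in>A. (v, f y) \<in> E ^^ l1 x y"
  shows "finite A \<Longrightarrow> A \<noteq> {} \<Longrightarrow> A \<subseteq> {x. length x = d} \<Longrightarrow> walk_compatible E f A \<Longrightarrow>
      length x = d \<Longrightarrow> \<exists>v. \<forall>y\<in>A. (v, f y) \<in> E ^^ l1 x y"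
proof (induction "card A" arbitrary: A f x rule: less_induct)
  case less
  show ?case
  proof (cases "card A \<le> 2 * d")
    case True
    then show ?thesis using base less.prems by blast
  next
    case False
    then obtain c where c: "c \<in> A"
      and up: "\<And>j. j < d \<Longrightarrow> \<exists>a\<in>A - {c}. c ! j \<le> a ! j"
      and down: "\<And>j. j < d \<Longrightarrow> \<exists>a\<in>A - {c}. a ! j \<le> c ! j"
      using exists_central_point[of A d] less.prems(1) by (metis not_le)
    have lenA: "length y = d" if "y \<in> A" for y using less.prems(3) that by auto
    show ?thesis using less.prems(5)
    proof (induction "l1 x c" arbitrary: x)
      case 0
      then have "x = c" using l1_eq_0[of x c] lenA[OF c] by simp
      then show ?case using less.prems(4) c by (auto simp: walk_compatible_def)
    next
      case (Suc k)
      have "x \<noteq> c" using Suc.hyps(2) by auto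
      then obtain j where j: "j < d" "x ! j \<noteq> c ! j"
        using Suc.prems lenA[OF c] by (auto simp: list_eq_iff_nth_eq)
      define z where "z = x[j := x ! j + sgn (c ! j - x ! j)]"
      have lz: "length z = d" using Suc.prems by (simp add: z_def)
      have xz: "l1 x z = 1" and xc: "l1 x c = Suc (l1 z c)"
        using l1_step[of j x c] j Suc.prems by (simp_all add: z_def)
      \<comment> \<open>As \<open>c\<close> is not strictly extremal, another point lies at least as
        far out as \<open>c\<close> on the same side of \<open>x\<close> in coordinate
        \<open>j\<close>.\<close>
      obtain a where a: "a \<in> A" "a \<noteq> c" "sgn (a ! j - x ! j) = sgn (c ! j - x ! j)"
      proof (cases "x ! j < c ! j")
        case True
        with up[OF j(1)] that show ?thesis by (fastforce simp: sgn_if)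
      next
        case False
        with down[OF j(1)] j(2) that show ?thesis by (fastforce simp: sgn_if)
      qed
      have "x ! j \<noteq> a ! j" using a(3) j(2) by (auto simp: sgn_if split: if_splits)
      then have xa: "l1 x a = Suc (l1 z a)"
        using l1_step(2)[of j x a] j Suc.prems by (simp add: z_def a(3))
      from Suc.hyps(1)[OF _ lz] Suc.hyps(2) xc
      obtain v where v: "\<And>y. y \<in> A \<Longrightarrow> (v, f y) \<in> E ^^ l1 z y" by auto
      \<comment> \<open>One point enters and two leave. No constraint is lost: a step to
        \<open>v\<close> followed by a walk from \<open>v\<close> serves both \<open>c\<close> and
        \<open>a\<close>.\<close>
      define B where "B = insert z (A - {c, a})"
      have "walk_compatible E (f(z := v)) (insert z A)"
        by (rule walk_compatible_insert) (use less.prems lenA lz v assms(1) in auto)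
      then have "walk_compatible E (f(z := v)) B"
        by (auto simp: walk_compatible_def B_def)
      moreover have "card B < card A"
      proof -
        have "card (A - {c, a}) = card A - 2"
          using c a by (subst card_Diff_subset) auto
        moreover have "card A \<ge> 2"
          using card_mono[of A "{c, a}"] c a less.prems(1) by auto
        moreover have "card B \<le> Suc (card (A - {c, a}))" 
          unfolding B_def by (rule card_insert_le_m1) auto
        ultimately show ?thesis by linarith
      qed
      moreover have "finite B" "B \<noteq> {}" "B \<subseteq> {x. length x = d}"
        using less.prems lz by (auto simp: B_def)
      ultimately obtain w where w: "\<And>y. y \<in> B \<Longrightarrow> (w, (f(z := v)) y) \<in> E ^^ l1 x y"
        using less.hyps[of B "f(z := v)" x] Suc.prems by blast
      have wv: "(w, v) \<in> E" using w[of z] xz by (simp add: B_def)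
      have "(w, f y) \<in> E ^^ l1 x y" if "y \<in> A" for y
      proof (cases "y = c \<or> y = a")
        case True
        then have "l1 x y = Suc (l1 z y)" using xa xc by auto
        then show ?thesis using wv v[OF that] by (metis relpow_Suc_I2)
      next
        case False
        show ?thesis
        \<comment> \<open>If \<open>z\<close> was already in \<open>A\<close>, the walk of length 0
          forces \<open>v = f z\<close>, so overwriting \<open>f\<close> at \<open>z\<close> changed
          nothing.\<close>
        proof (cases "y = z")
          case True
          with v[OF that] have "v = f y" by simp
          with w[of z] True show ?thesis by (simp add: B_def)
        qed (use w[of y] False that in \<open>simp add: B_def\<close>)
      qed
      then show ?case by blast
    qed
  qed
qed

text \<open>The points of \<open>B\<close> are added one at a time in any order; those already in
  \<open>A\<close> are skipped, so that \<open>f\<close> keeps its values there.\<close>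

lemma walk_compatible_extend_finite:
  assumes "sym E"
    and base: "\<And>A f x. finite A \<Longrightarrow> A \<noteq> {} \<Longrightarrow> card A \<le> 2 * d \<Longrightarrow> A \<subseteq> {x. length x = d} \<Longrightarrow>
      walk_compatible E f A \<Longrightarrow> length x = d \<Longrightarrow> \<exists>v. \<forall>y\<in>A. (v, f y) \<in> E ^^ l1 x y"
    and "finite A" "A \<noteq> {}" "A \<subseteq> {x. length x = d}" "walk_compatible E f A"
    and "finite B" "B \<subseteq> {x. length x = d}"
  shows "\<exists>g. walk_compatible E g (A \<union> B) \<and> (\<forall>x\<in>A. g x = f x)"
  using assms(7,8)
proof (induction B rule: finite_induct)
  case empty
  then show ?case using assms by auto
next
  case (insert x B)
  then obtain g where g: "walk_compatible E g (A \<union> B)" "\<forall>x\<in>A. g x = f x" by auto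
  show ?case
  proof (cases "x \<in> A")
    case True
    then show ?thesis using g by (auto simp: insert_absorb)
  next
    case False
    have len: "A \<union> B \<subseteq> {x. length x = d}" "length x = d" using insert.prems assms(5) by auto
    have "finite (A \<union> B)" "A \<union> B \<noteq> {}" using insert.hyps assms(3,4) by auto
    from walk_compatible_extend[OF assms(1) base this len(1) g(1) len(2)]
    obtain v where v: "\<forall>y\<in>A \<union> B. (v, g y) \<in> E ^^ l1 x y" by blast
    have "walk_compatible E (g(x := v)) (insert x (A \<union> B))"
    proof (rule walk_compatible_insert[OF assms(1) g(1)])
      show "length y = length x" if "y \<in> A \<union> B" for y using that len by blast
      show "A \<union> B \<noteq> {}" using assms(4) by blast
      show "(v, g y) \<in> E ^^ l1 x y" if "y \<in> A \<union> B" for y using v that by blast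
    qed
    moreover have "\<forall>y\<in>A. (g(x := v)) y = f y" using g(2) False by auto
    ultimately show ?thesis by (metis Un_insert_right)
  qed
qed

section \<open>Balls, parity and the Helly property\<close>

lemma (in pair_wf_digraph) pawalk_length_iff:
  "(\<exists>p. awalk u p v \<and> length p = k) \<longleftrightarrow> u \<in> pverts G \<and> (u, v) \<in> parcs G ^^ k"
proof (induction k arbitrary: u)
  case 0
  then show ?case by (auto simp: awalk_def)
next
  case (Suc k)
  have "(\<exists>p. awalk u p v \<and> length p = Suc k) \<longleftrightarrow>
      (\<exists>w. (u, w) \<in> parcs G \<and> (\<exists>p. awalk w p v \<and> length p = k))"
    unfolding length_Suc_conv by (metis awalk_Cons_iff fst_conv snd_conv prod.collapse)
  also have "\<dots> \<longleftrightarrow> u \<in> pverts G \<and> (u, v) \<in> parcs G ^^ Suc k"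
    unfolding Suc.IH using in_arcsD1 in_arcsD2 by (metis relpow_Suc_D2 relpow_Suc_I2)
  finally show ?case .
qed

text \<open>The metric is an infimum of walk lengths. These are natural numbers: if none is at most
  \<open>r\<close>, all are at least \<open>r + 1\<close>, and so is the infimum.\<close>

lemma (in pair_wf_digraph) mem_closed_ball_iff:
  "v \<in> closed_ball G u r \<longleftrightarrow> v \<in> pverts G \<and> u \<in> pverts G \<and> (\<exists>k\<le>r. (u, v) \<in> parcs G ^^ k)"
proof -
  have mu: "path_dist G u v = (INF p\<in>{p. awalk u p v}. ereal (length p))"
    by (simp add: path_dist_def \<mu>_def awalk_cost_def sum_list_triv)
  have "path_dist G u v \<le> ereal (real r) \<longleftrightarrow> (\<exists>p. awalk u p v \<and> length p \<le> r)"
  proof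
    assume *: "path_dist G u v \<le> ereal (real r)"
    show "\<exists>p. awalk u p v \<and> length p \<le> r"
    proof (rule ccontr)
      assume "\<not> ?thesis"
      then have "ereal (real (Suc r)) \<le> path_dist G u v"
        unfolding mu by (intro INF_greatest) (force simp: not_le)
      with * have "ereal (real (Suc r)) \<le> ereal (real r)" by (rule order_trans[rotated])
      then show False by simp
    qed
  next
    assume "\<exists>p. awalk u p v \<and> length p \<le> r"
    then show "path_dist G u v \<le> ereal (real r)"
      unfolding mu by (auto intro: INF_lower2)
  qed
  also have "\<dots> \<longleftrightarrow> u \<in> pverts G \<and> (\<exists>k\<le>r. (u, v) \<in> parcs G ^^ k)"
    using pawalk_length_iff by metis
  finally show ?thesis by (auto simp: closed_ball_def)
qed

lemma (in pair_wf_digraph) bipartition_relpow: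
  assumes "bipartition G X Y" "u \<in> pverts G" "(u, v) \<in> parcs G ^^ k"
  shows "v \<in> pverts G \<and> ((u \<in> X \<longleftrightarrow> v \<in> X) \<longleftrightarrow> even k)"
  using assms(3)
proof (induction k arbitrary: v)
  case (Suc k)
  then obtain w where w: "(u, w) \<in> parcs G ^^ k" "(w, v) \<in> parcs G" by auto
  have "w \<in> X \<longleftrightarrow> v \<in> Y" using assms(1) w(2) by (auto simp: bipartition_def)
  moreover have "v \<in> Y \<longleftrightarrow> v \<notin> X" using assms(1) in_arcsD2[OF w(2)] by (auto simp: bipartition_def)
  ultimately show ?case using Suc.IH[OF w(1)] in_arcsD2[OF w(2)] by auto
qed (use assms in simp)

text \<open>\<open>bipartition\<close> is worded asymmetrically; symmetry of the arcs lets either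
  class play the role of \<open>X\<close>.\<close>

lemma bipartition_swap:
  assumes "pair_sym_digraph H" "bipartition H X Y" shows "bipartition H Y X"
proof -
  interpret pair_sym_digraph H by fact
  have "(v, u) \<in> parcs H" if "(u, v) \<in> parcs H" for u v
    using pair_sym_arcs that by (auto simp: symmetric_def dest: symD)
  then show ?thesis using assms(2) unfolding bipartition_def by blast
qed

text \<open>A value at \<open>x\<close> must lie in the ball of radius \<open>l1 x y\<close> about
  each \<open>f y\<close>. Two such balls meet in the right class because a walk of length
  \<open>l1 y z\<close> can be padded to \<open>l1 x y + l1 x z\<close> and then split. The Helly
  property yields a common point, and parity turns its bounds on distances into exact
  lengths.\<close>

lemma helly_extend:
  assumes H: "pair_sym_digraph H" "bipartite_helly2 k H"
    and A: "finite A" "A \<noteq> {}" "card A \<le> k" "A \<subseteq> {x. length x = d}"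
    and f: "walk_compatible (parcs H) f A" and x: "length x = d"
  shows "\<exists>v. \<forall>y\<in>A. (v, f y) \<in> parcs H ^^ l1 x y"
proof -
  interpret pair_sym_digraph H by (fact H)
  have sym: "sym (parcs H)" using pair_sym_arcs by (simp add: symmetric_def)
  have dom: "f y \<in> Domain (parcs H)" "f y \<in> pverts H" if "y \<in> A" for y
    using f that in_arcsD1 by (auto simp: walk_compatible_def)
  have len: "length y = d" if "y \<in> A" for y using A(4) that by auto
  obtain a0 where a0: "a0 \<in> A" using A(2) by auto
  \<comment> \<open>The parity of \<open>l1 x a0\<close> decides in which class the value at
    \<open>x\<close> must lie; \<open>X\<close> names this class.\<close>
  obtain X Y where XY: "bipartition H X Y" "f a0 \<in> X \<longleftrightarrow> even (l1 x a0)"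
  proof -
    obtain X Y where *: "bipartition H X Y" using H(2) by (auto simp: bipartite_helly2_def)
    show thesis
    proof (cases "f a0 \<in> X \<longleftrightarrow> even (l1 x a0)")
      case True
      then show ?thesis using that * by blast
    next
      case False
      then have "f a0 \<in> Y \<longleftrightarrow> even (l1 x a0)"
        using * dom(2)[OF a0] by (auto simp: bipartition_def)
      then show ?thesis using that bipartition_swap[OF H(1) *] by blast
    qed
  qed
  have parity: "f y \<in> X \<longleftrightarrow> even (l1 x y)" if y: "y \<in> A" for y
  proof -
    have "(f a0, f y) \<in> parcs H ^^ l1 a0 y" using f a0 y by (auto simp: walk_compatible_def)
    from bipartition_relpow[OF XY(1) dom(2)[OF a0] this] XY(2)
      l1_parity[of a0 x y] len[OF a0] x show ?thesis by auto
  qed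
  have pair: "closed_ball H (f y) (l1 x y) \<inter> closed_ball H (f z) (l1 x z) \<inter> X \<noteq> {}"
    if yz: "y \<in> A" "z \<in> A" for y z
  proof -
    have *: "length x = length y" "length y = length x" using len[OF yz(1)] x by auto
    have "(f y, f z) \<in> parcs H ^^ l1 y z" using f yz by (auto simp: walk_compatible_def)
    moreover have "l1 y z \<le> l1 x y + l1 x z"
      using l1_triangle[OF *(1), of z] l1_commute[OF *(1)] by simp
    moreover from this have "even (l1 x y + l1 x z - l1 y z)"
      using l1_parity[OF *(2), of z] by presburger
    ultimately have "(f y, f z) \<in> parcs H ^^ (l1 x y + l1 x z)"
      using relpow_pad[OF sym dom(1)[OF yz(1)]] by blast
    then obtain v where v: "(f y, v) \<in> parcs H ^^ l1 x y" "(v, f z) \<in> parcs H ^^ l1 x z"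
      by (auto simp: relpow_add)
    note v' = bipartition_relpow[OF XY(1) dom(2)[OF yz(1)] v(1)]
    from v' parity[OF yz(1)] have "v \<in> X" by auto
    moreover have "v \<in> closed_ball H (f y) (l1 x y)"
      using v(1) v' dom(2)[OF yz(1)] by (auto simp: mem_closed_ball_iff)
    moreover have "v \<in> closed_ball H (f z) (l1 x z)"
      using relpow_sym[OF sym v(2)] v' dom(2)[OF yz(2)] by (auto simp: mem_closed_ball_iff)
    ultimately show ?thesis by blast
  qed
  obtain h where h: "bij_betw h {0..<card A} A" using ex_bij_betw_nat_finite[OF A(1)] by auto
  \<comment> \<open>The Helly property speaks of exactly \<open>k\<close> balls, so surplus indices
    repeat the ball at \<open>a0\<close>; \<open>pair\<close> therefore also covers
    \<open>y = z\<close>.\<close>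
  define a where "a i = (if i < card A then h i else a0)" for i
  have a: "a i \<in> A" for i using h a0 by (auto simp: a_def bij_betw_def)
  have "(\<Inter>i\<in>{..<k}. closed_ball H (f (a i)) (l1 x (a i)) \<inter> X) \<noteq> {}"
  proof -
    have "\<forall>i<k. f (a i) \<in> pverts H" using dom(2) a by simp
    moreover have "\<forall>i<k. \<forall>j<k. i \<noteq> j \<longrightarrow>
        closed_ball H (f (a i)) (l1 x (a i)) \<inter> closed_ball H (f (a j)) (l1 x (a j)) \<inter> X \<noteq> {}"
      using pair a by simp
    ultimately show ?thesis
      by (intro H(2)[unfolded bipartite_helly2_def, THEN conjunct2, rule_format] conjI)
        (use XY(1) in simp_all)
  qed
  then obtain w where w: "\<And>i. i < k \<Longrightarrow> w \<in> closed_ball H (f (a i)) (l1 x (a i)) \<inter> X" by blast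
  have "(w, f y) \<in> parcs H ^^ l1 x y" if y: "y \<in> A" for y
  proof -
    obtain i where "i < card A" "h i = y" using h y by (force simp: bij_betw_def)
    then have "w \<in> closed_ball H (f y) (l1 x y)" "w \<in> X" using w[of i] A(3) by (auto simp: a_def)
    then obtain l where l: "l \<le> l1 x y" "(f y, w) \<in> parcs H ^^ l"
      by (auto simp: mem_closed_ball_iff)
    \<comment> \<open>The classes of both ends are known, so every walk between them has the parity
      of \<open>l1 x y\<close> and can be padded to that length.\<close>
    have "even l \<longleftrightarrow> even (l1 x y)"
      using bipartition_relpow[OF XY(1) dom(2)[OF y] l(2)] parity[OF y] \<open>w \<in> X\<close> by auto
    then have "(f y, w) \<in> parcs H ^^ l1 x y"
      using relpow_pad[OF sym dom(1)[OF y] l(2,1)] l(1) by simp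
    then show ?thesis by (rule relpow_sym[OF sym])
  qed
  then show ?thesis by blast
qed

section \<open>Boxes and the extension criterion\<close>

lemma verts_box: "verts (box d n) = {x. length x = d \<and> set x \<subseteq> {0..int n}}"
  by (simp add: box_def)

lemma verts_box_boundary:
  "verts (box_boundary d n) = {x \<in> verts (box d n). \<exists>i<d. x ! i = 0 \<or> x ! i = int n}"
  by (simp add: box_boundary_def)

lemma box_dominates_iff:
  "x \<rightarrow>\<^bsub>box d n\<^esub> y \<longleftrightarrow> x \<in> verts (box d n) \<and> y \<in> verts (box d n) \<and>
     (\<exists>i<d. y = x[i := x ! i + 1] \<or> y = x[i := x ! i - 1])"
  by (auto simp: arcs_ends_conv box_def cayley_Z_def image_iff)

lemma finite_verts_box: "finite (verts (box d n))"
  unfolding verts_box using finite_lists_length_eq[of "{0..int n}" d] by (simp add: conj_commute)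

text \<open>Boxes are convex: moving a coordinate of \<open>x\<close> towards that of
  \<open>y\<close> stays between 0 and \<open>n\<close>, so some lattice geodesic runs inside the
  box, though perhaps not inside its boundary.\<close>

lemma Hom_box_relpow:
  assumes "g \<in> Hom (box d n) H" "x \<in> verts (box d n)" "y \<in> verts (box d n)"
  shows "(g x, g y) \<in> arcs_ends H ^^ l1 x y"
  using assms(2)
proof (induction "l1 x y" arbitrary: x)
  case 0
  then have "x = y" using assms(3) by (auto simp: verts_box l1_eq_0)
  then show ?case by simp
next
  case (Suc k)
  then have len: "length x = d" "length y = d" using assms(3) by (auto simp: verts_box)
  have "x \<noteq> y" using Suc.hyps(2) by auto
  with len obtain j where j: "j < d" "x ! j \<noteq> y ! j" by (auto simp: list_eq_iff_nth_eq)
  define z where "z = x[j := x ! j + sgn (y ! j - x ! j)]"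
  have "x ! j \<in> set x" "y ! j \<in> set y" using j(1) len by simp_all
  then have "x ! j \<in> {0..int n}" "y ! j \<in> {0..int n}"
    using Suc.prems assms(3) by (auto simp: verts_box)
  then have "z \<in> verts (box d n)"
    using Suc.prems j(2) set_update_subset_insert[of x j "x ! j + sgn (y ! j - x ! j)"]
    by (auto simp: verts_box z_def sgn_if split: if_splits)
  moreover have "z = x[j := x ! j + 1] \<or> z = x[j := x ! j - 1]"
    using j(2) by (auto simp: z_def sgn_if)
  ultimately have "(g x, g z) \<in> arcs_ends H"
    using assms(1) j(1) Suc.prems unfolding Hom_def by (auto simp: box_dominates_iff)
  moreover have "l1 x y = Suc (l1 z y)" using l1_step(2)[of j x y] j len by (simp add: z_def)
  ultimately show ?case using Suc.hyps \<open>z \<in> verts (box d n)\<close> by (metis Suc_inject relpow_Suc_I2)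
qed

theorem hole_filling_iff:
  assumes "d \<ge> 1" "n \<ge> 1" and H: "pair_sym_digraph H" "bipartite_helly2 (2 * d) H"
  shows "(\<exists>g \<in> Hom (box d n) H. \<forall>x \<in> verts (box_boundary d n). g x = f x) \<longleftrightarrow>
    (\<forall>x \<in> verts (box_boundary d n). \<forall>y \<in> verts (box_boundary d n).
       (f x, f y) \<in> parcs H ^^ l1 x y)" (is "?L \<longleftrightarrow> ?R")
proof
  assume ?L
  then obtain g where g: "g \<in> Hom (box d n) H" "\<forall>x \<in> verts (box_boundary d n). g x = f x" by blast
  have "(g x, g y) \<in> parcs H ^^ l1 x y"
    if "x \<in> verts (box_boundary d n)" "y \<in> verts (box_boundary d n)" for x y
    using Hom_box_relpow[OF g(1)] that by (simp add: verts_box_boundary)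
  then show ?R using g(2) by simp
next
  assume R: ?R
  interpret pair_sym_digraph H by (fact H)
  have sym: "sym (parcs H)" using pair_sym_arcs by (simp add: symmetric_def)
  let ?A = "verts (box_boundary d n)"
  \<comment> \<open>As \<open>n \<ge> 1\<close>, every \<open>x\<close> differs from one of the
    corners (0,...,0) and (n,...,n). The walk of positive length from \<open>f x\<close> to the
    value there supplies the neighbour that \<open>walk_compatible\<close> asks for.\<close>
  have corner: "replicate d c \<in> ?A" if "c = 0 \<or> c = int n" for c
    using that assms(1) by (auto simp: verts_box_boundary verts_box intro!: exI[of _ 0])
  have "f x \<in> Domain (parcs H)" if x: "x \<in> ?A" for x
  proof -
    have "x ! 0 \<noteq> 0 \<or> x ! 0 \<noteq> int n" using assms(2) by auto
    then obtain c where c: "c = 0 \<or> c = int n" "x ! 0 \<noteq> c" by blast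
    then have "x \<noteq> replicate d c" using assms(1) by auto
    moreover have "length x = length (replicate d c)"
      using x by (simp add: verts_box_boundary verts_box)
    ultimately obtain k where "l1 x (replicate d c) = Suc k"
      using l1_eq_0 not0_implies_Suc by blast
    then have "(f x, f (replicate d c)) \<in> parcs H ^^ Suc k" using R x corner[OF c(1)] by metis
    then show ?thesis by (meson relpow_Suc_D2 DomainI)
  qed
  then have compat: "walk_compatible (parcs H) f ?A" using R by (auto simp: walk_compatible_def)
  have "?A \<noteq> {}" using corner by blast
  moreover have "finite ?A" using finite_verts_box[of d n] by (simp add: verts_box_boundary)
  moreover have "?A \<subseteq> {x. length x = d}" by (auto simp: verts_box_boundary verts_box)
  moreover have "verts (box d n) \<subseteq> {x. length x = d}" by (auto simp: verts_box)
  ultimately have "\<exists>g. walk_compatible (parcs H) g (?A \<union> verts (box d n)) \<and> (\<forall>x\<in>?A. g x = f x)"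
    by (intro walk_compatible_extend_finite[OF sym helly_extend[OF H]] compat finite_verts_box)
  then obtain g where
    g: "walk_compatible (parcs H) g (?A \<union> verts (box d n))" "\<forall>x\<in>?A. g x = f x" by blast
  have "g \<in> Hom (box d n) H"
  proof -
    \<comment> \<open>Adjacent points are at distance 1, and a walk of length 1 is an arc.\<close>
    have "(g x, g y) \<in> parcs H" if xy: "x \<rightarrow>\<^bsub>box d n\<^esub> y" for x y
    proof -
      obtain i where i: "i < d" "y = x[i := x ! i + 1] \<or> y = x[i := x ! i - 1]" "length x = d"
        using xy by (auto simp: box_dominates_iff verts_box)
      then have "x ! i \<noteq> y ! i" "x[i := x ! i + sgn (y ! i - x ! i)] = y" by auto
      then have "l1 x y = 1" using l1_step(1)[of i x y] i by simp
      moreover have "(g x, g y) \<in> parcs H ^^ l1 x y"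
        using g(1) xy by (auto simp: walk_compatible_def box_dominates_iff)
      ultimately show ?thesis by simp
    qed
    moreover have "g x \<in> pverts H" if "x \<in> verts (box d n)" for x
      using g(1) that in_arcsD1 unfolding walk_compatible_def by blast
    ultimately show ?thesis by (auto simp: Hom_def)
  qed
  with g(2) show ?L by blast
qed

section \<open>Running time of programs with counted loops\<close>

text \<open>\<open>K\<close> stands for a bound on the number of iterations of every single execution of a loop.\<close>

primrec time_bound :: "nat \<Rightarrow> prog \<Rightarrow> nat" where
  "time_bound K Skip = 1"
| "time_bound K (SetReg i e) = cost_expr e + 1"
| "time_bound K (SetMem a e) = cost_expr a + cost_expr e + 1"
| "time_bound K (Seq p q) = time_bound K p + time_bound K q"
| "time_bound K (IfNonzero e p q) = cost_expr e + 1 + time_bound K p + time_bound K q"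
| "time_bound K (WhileNonzero e p) = (K + 1) * (cost_expr e + 1 + time_bound K p)"

text \<open>Each loop contributes a factor \<open>K + 1\<close>, so the degree is bounded by the
  nesting depth of the loops in the fixed program.\<close>

lemma time_bound_poly: "\<exists>q :: nat poly. \<forall>K. time_bound K p = poly q K"
proof (induction p)
  case Skip
  show ?case by (rule exI[of _ "[:1:]"]) simp
next
  case (SetReg i e)
  show ?case by (rule exI[of _ "[:cost_expr e + 1:]"]) simp
next
  case (SetMem a e)
  show ?case by (rule exI[of _ "[:cost_expr a + cost_expr e + 1:]"]) simp
next
  case (Seq p q)
  then obtain P Q where "\<forall>K. time_bound K p = poly P K" "\<forall>K. time_bound K q = poly Q K" by blast
  then show ?case by (intro exI[of _ "P + Q"]) simp
next
  case (IfNonzero e p q)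
  then obtain P Q where "\<forall>K. time_bound K p = poly P K" "\<forall>K. time_bound K q = poly Q K" by blast
  then show ?case by (intro exI[of _ "[:cost_expr e + 1:] + P + Q"]) simp
next
  case (WhileNonzero e p)
  then obtain P where "\<forall>K. time_bound K p = poly P K" by blast
  then show ?case by (intro exI[of _ "[:1, 1:] * ([:cost_expr e + 1:] + P)"]) simp
qed

section \<open>Total correctness with a time bound\<close>

text \<open>The time bound is read off the program text. Only the rule for loops has to compute with
  it; proofs about programs merely check that loop counts are at most \<open>K\<close>.\<close>

definition wp :: "nat \<Rightarrow> prog \<Rightarrow> store \<Rightarrow> (store \<Rightarrow> bool) \<Rightarrow> bool" where
  "wp K p s Q \<longleftrightarrow> (\<exists>t s'. runs p s t s' \<and> t \<le> time_bound K p \<and> Q s')"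

lemma wp_mono: "wp K p s Q \<Longrightarrow> (\<And>s'. Q s' \<Longrightarrow> R s') \<Longrightarrow> wp K p s R"
  unfolding wp_def by blast

lemma wp_Skip: "Q s \<Longrightarrow> wp K Skip s Q"
  unfolding wp_def using runs.Skip by fastforce

lemma wp_SetReg: "Q ((fst s)(i := eval_expr e s), snd s) \<Longrightarrow> wp K (SetReg i e) s Q"
  unfolding wp_def using runs.SetReg by fastforce

lemma wp_SetMem:
  "Q (fst s, (snd s)(eval_expr a s := eval_expr e s)) \<Longrightarrow> wp K (SetMem a e) s Q"
  unfolding wp_def using runs.SetMem by fastforce

lemma wp_Seq: "wp K p s (\<lambda>s'. wp K q s' Q) \<Longrightarrow> wp K (Seq p q) s Q"
  unfolding wp_def using runs.Seq by (metis add_mono time_bound.simps(4))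

lemma wp_IfNonzero:
  assumes "eval_expr e s \<noteq> 0 \<Longrightarrow> wp K p s Q" "eval_expr e s = 0 \<Longrightarrow> wp K q s Q"
  shows "wp K (IfNonzero e p q) s Q"
proof (cases "eval_expr e s = 0")
  case True
  with assms(2) obtain t s' where "runs q s t s'" "t \<le> time_bound K q" "Q s'"
    by (auto simp: wp_def)
  with runs.IfFalse[OF True this(1)] show ?thesis
    unfolding wp_def by (intro exI conjI) auto
next
  case False
  with assms(1) obtain t s' where "runs p s t s'" "t \<le> time_bound K p" "Q s'"
    by (auto simp: wp_def)
  with runs.IfTrue[OF False this(1)] show ?thesis
    unfolding wp_def by (intro exI conjI) auto
qed

text \<open>The counter descends, as the machine only tests for zero. It is decremented before the
  body, which thus sees the values from one below the bound down to 0. The bound is evaluated once,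
  so \<open>e\<close> may mention \<open>r\<close> itself.\<close>

definition For :: "nat \<Rightarrow> expr \<Rightarrow> prog \<Rightarrow> prog" where
  "For r e p = Seq (SetReg r e)
     (WhileNonzero (Reg r) (Seq (SetReg r (Minus (Reg r) (Const 1))) p))"

text \<open>\<open>I k\<close> is the invariant with \<open>k\<close> rounds left. The body must
  return the counter unchanged, which fixes the number of rounds in advance.\<close>

lemma wp_For:
  assumes "eval_expr e s \<le> K"
    and init: "I (eval_expr e s) ((fst s)(r := eval_expr e s), snd s)"
    and step: "\<And>k s'. k < eval_expr e s \<Longrightarrow> fst s' r = Suc k \<Longrightarrow> I (Suc k) s' \<Longrightarrow>
      wp K p ((fst s')(r := k), snd s') (\<lambda>s''. fst s'' r = k \<and> I k s'')"
    and final: "\<And>s'. fst s' r = 0 \<Longrightarrow> I 0 s' \<Longrightarrow> Q s'"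
  shows "wp K (For r e p) s Q"
proof -
  let ?p = "Seq (SetReg r (Minus (Reg r) (Const 1))) p"
  let ?c = "cost_expr (Reg r) + 1 + time_bound K ?p"
  \<comment> \<open>The summand 1 in \<open>k + 1\<close> pays for the final test, which
    fails.\<close>
  have loop: "\<exists>t s''. runs (WhileNonzero (Reg r) ?p) s' t s'' \<and> t \<le> (k + 1) * ?c \<and> Q s''"
    if "k \<le> eval_expr e s" "fst s' r = k" "I k s'" for k s'
    using that
  proof (induction k arbitrary: s')
    case 0
    have "runs (WhileNonzero (Reg r) ?p) s' (cost_expr (Reg r) + 1) s'"
      by (rule runs.WhileFalse) (simp add: 0)
    then show ?case using final[OF 0(2,3)] by fastforce
  next
    case (Suc k)
    have "wp K ?p s' (\<lambda>s''. fst s'' r = k \<and> I k s'')"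
      using step[OF _ Suc.prems(2,3)] Suc.prems by (intro wp_Seq wp_SetReg) simp
    then obtain t1 s1 where 1: "runs ?p s' t1 s1" "t1 \<le> time_bound K ?p" "fst s1 r = k" "I k s1"
      by (auto simp: wp_def)
    obtain t2 s2 where 2: "runs (WhileNonzero (Reg r) ?p) s1 t2 s2" "t2 \<le> (k + 1) * ?c" "Q s2"
      using Suc.IH[OF _ 1(3,4)] Suc.prems(1) by auto
    have "runs (WhileNonzero (Reg r) ?p) s' (cost_expr (Reg r) + 1 + t1 + t2) s2"
      using Suc.prems(2) by (intro runs.WhileTrue[OF _ 1(1) 2(1)]) simp
    moreover have "cost_expr (Reg r) + 1 + t1 + t2 \<le> (Suc k + 1) * ?c" using 1(2) 2(2) by simp
    ultimately show ?case using 2(3) by blast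
  qed
  obtain t s'' where *: "runs (WhileNonzero (Reg r) ?p) ((fst s)(r := eval_expr e s), snd s) t s''"
      "t \<le> (eval_expr e s + 1) * ?c" "Q s''"
    using loop[OF le_refl _ init] by auto
  have "t \<le> (K + 1) * ?c" using *(2) assms(1) by (meson add_le_mono1 le_trans mult_le_mono1)
  then show ?thesis
    unfolding wp_def For_def using runs.Seq[OF runs.SetReg *(1)] *(3) by fastforce
qed

section \<open>Table positions in base n + 1\<close>

lemma horner_less:
  "set xs \<subseteq> {..n} \<Longrightarrow> horner_sum (\<lambda>x. x) (Suc n) xs < Suc n ^ length xs"
proof (induction xs)
  case (Cons x xs)
  then have "Suc (horner_sum (\<lambda>x. x) (Suc n) xs) \<le> Suc n ^ length xs" "x \<le> n" by auto
  then have "Suc n * Suc (horner_sum (\<lambda>x. x) (Suc n) xs) \<le> Suc n * Suc n ^ length xs"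
    by (intro mult_left_mono) auto
  with \<open>x \<le> n\<close> show ?case by (simp add: algebra_simps)
qed simp

text \<open>Gives the size of the table without computing a power: the address routine, applied to
  the last point, falls short of it by 1.\<close>

lemma horner_replicate: "Suc (horner_sum (\<lambda>x. x) (Suc n) (replicate d n)) = Suc n ^ d"
proof (induction d)
  case (Suc d)
  have "Suc (horner_sum (\<lambda>x. x) (Suc n) (replicate (Suc d) n))
      = Suc n * Suc (horner_sum (\<lambda>x. x) (Suc n) (replicate d n))" by simp
  then show ?case unfolding Suc.IH by simp
qed simp

text \<open>The coordinates are digits in base \<open>n + 1\<close>, least significant first.
  Multiplication by \<open>n + 1\<close> is repeated addition: register 4 already holds one copy of
  the value saved in register 5, and the loop adds \<open>n\<close> more.\<close>

fun horner :: "expr list \<Rightarrow> prog" where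
  "horner [] = SetReg 4 (Const 0)"
| "horner (e # es) = Seq (horner es) (Seq (SetReg 5 (Reg 4))
     (Seq (For 6 (Mem (Const 0)) (SetReg 4 (Plus (Reg 4) (Reg 5)))) (SetReg 4 (Plus (Reg 4) e))))"

text \<open>The condition on \<open>es\<close> says that their values do not depend on registers 4,
  5 and 6, which are overwritten between the evaluations.\<close>

lemma wp_horner:
  assumes "snd s 0 \<le> K"
    and "\<And>e s'. e \<in> set es \<Longrightarrow> (\<And>r. r \<notin> {4,5,6} \<Longrightarrow> fst s' r = fst s r) \<Longrightarrow> snd s' = snd s \<Longrightarrow>
      eval_expr e s' = eval_expr e s"
  shows "wp K (horner es) s (\<lambda>s'. (\<forall>r. r \<notin> {4,5,6} \<longrightarrow> fst s' r = fst s r) \<and> snd s' = snd s \<and>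
    fst s' 4 = horner_sum (\<lambda>x. x) (Suc (snd s 0)) (map (\<lambda>e. eval_expr e s) es))"
  using assms(2)
proof (induction es)
  case Nil
  show ?case by (auto intro!: wp_SetReg)
next
  case (Cons e es)
  define h where "h = horner_sum (\<lambda>x. x) (Suc (snd s 0)) (map (\<lambda>e. eval_expr e s) es)"
  define F where "F s' \<longleftrightarrow> (\<forall>r. r \<notin> {4,5,6} \<longrightarrow> fst s' r = fst s r) \<and> snd s' = snd s" for s'
  have e: "eval_expr e s' = eval_expr e s" if "F s'" for s'
    by (rule Cons.prems) (use that in \<open>simp_all add: F_def\<close>)
  have N: "snd s' 0 = snd s 0" if "F s'" for s' using that by (simp add: F_def)
  have "wp K (horner es) s (\<lambda>s'. F s' \<and> fst s' 4 = h)"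
    unfolding F_def h_def conj_assoc by (rule Cons.IH) (rule Cons.prems, simp_all)
  moreover have "wp K (Seq (SetReg 5 (Reg 4)) (Seq (For 6 (Mem (Const 0)) (SetReg 4 (Plus (Reg 4) (Reg 5))))
      (SetReg 4 (Plus (Reg 4) e)))) s1 (\<lambda>s'. F s' \<and> fst s' 4 = eval_expr e s + Suc (snd s 0) * h)"
    if s1: "F s1" "fst s1 4 = h" for s1
  proof (intro wp_Seq wp_SetReg, rule wp_For[where I = "\<lambda>k s'. F s' \<and> fst s' 5 = h \<and>
      fst s' 4 = h + (snd s 0 - k) * h"], goal_cases)
    case 1
    show ?case using N[OF s1(1)] assms(1) by simp
  next
    case 2
    show ?case using s1 N[OF s1(1)] by (simp add: F_def)
  next
    case (3 k s')
    then have "k < snd s 0" using N[OF s1(1)] by simp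
    then have "snd s 0 - k = Suc (snd s 0 - Suc k)" by simp
    then have "(snd s 0 - k) * h = h + (snd s 0 - Suc k) * h" by (simp only: mult_Suc)
    with 3 show ?case by (intro wp_SetReg) (simp add: F_def)
  next
    case (4 s')
    then show ?case using e[OF conjunct1[OF 4(2)]] by (intro wp_SetReg) (simp add: F_def)
  qed
  ultimately have "wp K (horner (e # es)) s (\<lambda>s'. F s' \<and> fst s' 4 = eval_expr e s + Suc (snd s 0) * h)"
    unfolding horner.simps by (intro wp_Seq[of K "horner es"]) (elim wp_mono, blast)
  then show ?case by (elim wp_mono) (simp add: F_def h_def)
qed

section \<open>The program\<close>

definition sum_expr :: "expr list \<Rightarrow> expr" where
  "sum_expr es = foldr Plus es (Const 0)"

lemma eval_sum_expr: "eval_expr (sum_expr es) s = (\<Sum>e\<leftarrow>es. eval_expr e s)"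
  by (induction es) (simp_all add: sum_expr_def)

text \<open>The nest of loops is written out in the program text, which is possible because
  \<open>d\<close> is fixed. The bound \<open>n + 1\<close> makes each counter run through 0 to
  \<open>n\<close>.\<close>

fun foralls :: "nat list \<Rightarrow> prog \<Rightarrow> prog" where
  "foralls [] p = p"
| "foralls (r # rs) p = For r (Plus (Mem (Const 0)) (Const 1)) (foralls rs p)"

text \<open>Registers 1 and 2 hold the addresses of the table and of the scratch memory.  The walks run
  from the vertex in register 8 to the vertex in register 7 and have the length in register 9;
  register 10 holds the address of the current layer, whose cell \<open>w\<close> counts the walks from \<open>w\<close>.
  The coordinates of the two boundary points are in the registers from 16 on.\<close>

definition walk_row :: prog where
  "walk_row = Seq (SetReg 13 (Const 2))
    (Seq (For 14 (Reg 11) (SetReg 13 (Plus (Reg 13) (Mem (Const 1)))))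
    (Seq (SetReg 15 (Const 0))
      (For 12 (Mem (Const 1)) (IfNonzero (Mem (Plus (Reg 13) (Reg 12)))
        (SetReg 15 (Plus (Reg 15) (Mem (Plus (Reg 10) (Reg 12))))) Skip))))"

text \<open>The new layer goes to the \<open>m\<close> cells after the old one, which is still being
  read while the sums are formed.\<close>

definition walk_layer :: prog where
  "walk_layer = Seq
    (For 11 (Mem (Const 1))
      (Seq walk_row (SetMem (Plus (Plus (Reg 10) (Mem (Const 1))) (Reg 11)) (Reg 15))))
    (SetReg 10 (Plus (Reg 10) (Mem (Const 1))))"

text \<open>Layer 0 is cleared because the scratch memory may hold remains of an earlier pair. The
  register with the length is reused as the counter.\<close>

definition walk_layers :: prog where
  "walk_layers = Seq (SetReg 10 (Reg 2))
    (Seq (For 11 (Mem (Const 1)) (SetMem (Plus (Reg 10) (Reg 11)) (Const 0)))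
    (Seq (SetMem (Plus (Reg 10) (Reg 7)) (Const 1))
      (For 9 (Reg 9) walk_layer)))"

text \<open>The flag in register 0 is only ever lowered, so in the end it is the conjunction of all
  tests.\<close>

definition walk_check :: prog where
  "walk_check = Seq walk_layers
    (IfNonzero (Mem (Plus (Reg 10) (Reg 8))) Skip (SetReg 0 (Const 0)))"

text \<open>Truncated subtraction serves as a test: \<open>1 - x\<close> is 1 iff
  \<open>x = 0\<close>, and \<open>1 - (n - x)\<close> is 1 iff \<open>x \<ge> n\<close>.\<close>

definition boundary_expr :: "nat list \<Rightarrow> expr" where
  "boundary_expr rs = sum_expr (map (\<lambda>r. Plus (Minus (Const 1) (Reg r))
     (Minus (Const 1) (Minus (Mem (Const 0)) (Reg r)))) rs)"

definition dist_expr :: "nat list \<Rightarrow> nat list \<Rightarrow> expr" where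
  "dist_expr rs rs' = sum_expr (map (\<lambda>(r, r'). Plus (Minus (Reg r) (Reg r')) (Minus (Reg r') (Reg r)))
     (zip rs rs'))"

definition pair_check :: "nat list \<Rightarrow> nat list \<Rightarrow> prog" where
  "pair_check rs rs' = IfNonzero (boundary_expr rs) (IfNonzero (boundary_expr rs')
     (Seq (horner (map Reg rs)) (Seq (SetReg 8 (Mem (Plus (Reg 1) (Reg 4))))
     (Seq (horner (map Reg rs')) (Seq (SetReg 7 (Mem (Plus (Reg 1) (Reg 4))))
     (Seq (SetReg 9 (dist_expr rs rs')) walk_check)))))
     Skip) Skip"

text \<open>Register 1 becomes \<open>2 + m * m\<close>, the start of the table. The scratch memory
  begins one cell past the entry of the point with all coordinates \<open>n\<close>.\<close>

definition setup_prog :: "nat \<Rightarrow> prog" where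
  "setup_prog d = Seq (SetReg 1 (Const 2))
    (Seq (For 3 (Mem (Const 1)) (SetReg 1 (Plus (Reg 1) (Mem (Const 1)))))
    (Seq (horner (replicate d (Mem (Const 0))))
    (Seq (SetReg 2 (Plus (Plus (Reg 1) (Reg 4)) (Const 1))) (SetReg 0 (Const 1)))))"

text \<open>The coordinate registers start at 16, above all registers with a fixed purpose.\<close>

definition hole_filling_prog :: "nat \<Rightarrow> prog" where
  "hole_filling_prog d = Seq (setup_prog d)
     (foralls ([16..<16 + d] @ [16 + d..<16 + d + d])
       (pair_check [16..<16 + d] [16 + d..<16 + d + d]))"

section \<open>Verification of the walk counts\<close>

definition dist_nat :: "nat list \<Rightarrow> nat list \<Rightarrow> nat" where
  "dist_nat xs ys = (\<Sum>(x, y)\<leftarrow>zip xs ys. (x - y) + (y - x))"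

text \<open>The input occupies the cells below \<open>S\<close>; the layers of the walk table start at \<open>S\<close>.\<close>

locale machine_input =
  fixes n m d K S :: nat and M :: "nat \<Rightarrow> nat"
  assumes M01: "M 0 = n" "M 1 = m"
    and S: "S = 2 + m * m + Suc n ^ d"
    and K: "n < K" "m \<le> K" "d * n \<le> K"
begin

lemma S01: "0 < S" "Suc 0 < S"
  by (simp_all add: S)

text \<open>The recursion is on the first step, with the end \<open>u\<close> fixed: a cell of the
  new layer then needs one row of the matrix and the old layer.\<close>

fun walks :: "nat \<Rightarrow> nat \<Rightarrow> nat \<Rightarrow> nat" where
  "walks u 0 w = of_bool (w = u)"
| "walks u (Suc j) w = (\<Sum>v<m. if M (2 + w * m + v) \<noteq> 0 then walks u j v else 0)"

text \<open>Nothing is demanded from \<open>S\<close> on, so the invariant survives all writes to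
  the scratch memory.\<close>

definition input_ok :: "store \<Rightarrow> bool" where
  "input_ok s \<longleftrightarrow> (\<forall>a<S. snd s a = M a)"

lemma input_ok_01: "input_ok s \<Longrightarrow> snd s 0 = n" "input_ok s \<Longrightarrow> snd s (Suc 0) = m"
  using M01 by (simp_all add: input_ok_def S01)

lemma adj_address: "w < m \<Longrightarrow> v < m \<Longrightarrow> 2 + w * m + v < S"
proof -
  assume "w < m" "v < m"
  then have "w * m + v < Suc w * m" by simp
  also have "\<dots> \<le> m * m" using \<open>w < m\<close> by (intro mult_right_mono) auto
  finally show ?thesis by (simp add: S)
qed

lemma wp_walk_row:
  assumes "input_ok s" "fst s 11 < m" "\<And>v. v < m \<Longrightarrow> snd s (fst s 10 + v) = walks u j v"
  shows "wp K walk_row s (\<lambda>s'. snd s' = snd s \<and> (\<forall>r. r \<notin> {12,13,14,15} \<longrightarrow> fst s' r = fst s r) \<and>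
    fst s' 15 = walks u (Suc j) (fst s 11))"
  unfolding walk_row_def
proof (intro wp_Seq wp_SetReg, rule wp_For[where I = "\<lambda>k s'. snd s' = snd s \<and>
    (\<forall>r. r \<notin> {12,13,14,15} \<longrightarrow> fst s' r = fst s r) \<and> fst s' 13 = 2 + (fst s 11 - k) * m"], goal_cases)
  case (3 k s')
  then have "fst s 11 - k = Suc (fst s 11 - Suc k)" by (simp add: Suc_diff_Suc)
  with 3 show ?case using input_ok_01[OF assms(1)] by (intro wp_SetReg) auto
next
  case (4 s')
  let ?f = "\<lambda>v. if M (2 + fst s 11 * m + v) \<noteq> 0 then walks u j v else 0"
  show ?case
  \<comment> \<open>The counter descends, so the partial sum covers the indices from
    \<open>k\<close> to \<open>m - 1\<close>.\<close>
  proof (intro wp_Seq wp_SetReg, rule wp_For[where I = "\<lambda>k s'. snd s' = snd s \<and>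
      (\<forall>r. r \<notin> {12,13,14,15} \<longrightarrow> fst s' r = fst s r) \<and> fst s' 13 = 2 + fst s 11 * m \<and>
      fst s' 15 = sum ?f {k..<m}"], goal_cases)
    case (3 k s'')
    then have k: "k < m" using 4 input_ok_01[OF assms(1)] by simp
    have adj: "snd s (2 + fst s 11 * m + k) = M (2 + fst s 11 * m + k)"
      using assms(1) adj_address[OF assms(2) k] by (simp add: input_ok_def)
    have "sum ?f {k..<m} = ?f k + sum ?f {Suc k..<m}" using k by (rule sum.atLeast_Suc_lessThan)
    with 3 adj assms(3)[OF k] show ?case by (intro wp_IfNonzero wp_SetReg wp_Skip) auto
  qed (use 4 K input_ok_01[OF assms(1)] in \<open>auto simp: atLeast0LessThan\<close>)
qed (use assms K in auto)

lemma wp_walk_layer: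
  assumes "input_ok s" "S \<le> fst s 10" "\<And>v. v < m \<Longrightarrow> snd s (fst s 10 + v) = walks u j v"
  shows "wp K walk_layer s (\<lambda>s'. input_ok s' \<and> (\<forall>r. r \<notin> {10..15} \<longrightarrow> fst s' r = fst s r) \<and>
    S \<le> fst s' 10 \<and> (\<forall>v<m. snd s' (fst s' 10 + v) = walks u (Suc j) v))"
  unfolding walk_layer_def
\<comment> \<open>All writes go to \<open>fst s 10 + m\<close> or beyond; as
  \<open>S \<le> fst s 10\<close>, the input and the layer being read stay intact.\<close>
proof (intro wp_Seq, rule wp_For[where I = "\<lambda>k s'.
    (\<forall>r. r \<notin> {11..15} \<longrightarrow> fst s' r = fst s r) \<and> (\<forall>a < fst s 10 + m. snd s' a = snd s a) \<and>
    (\<forall>v<m. k \<le> v \<longrightarrow> snd s' (fst s 10 + m + v) = walks u (Suc j) v)"], goal_cases)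
  case (3 k s')
  then have k: "k < m" using input_ok_01[OF assms(1)] by simp
  have ok: "input_ok s'" using assms(1,2) 3 by (auto simp: input_ok_def)
  let ?s = "((fst s')(11 := k), snd s')"
  have "wp K walk_row ?s (\<lambda>s''. snd s'' = snd ?s \<and> (\<forall>r. r \<notin> {12,13,14,15} \<longrightarrow> fst s'' r = fst ?s r) \<and>
    fst s'' 15 = walks u (Suc j) (fst ?s 11))"
    by (rule wp_walk_row) (use ok 3 assms(3) k in \<open>auto simp: input_ok_def\<close>)
  then show ?case
  proof (intro wp_Seq, elim wp_mono, intro wp_SetMem, elim conjE)
    fix s''
    assume *: "snd s'' = snd ?s" "\<forall>r. r \<notin> {12,13,14,15} \<longrightarrow> fst s'' r = fst ?s r"
      "fst s'' 15 = walks u (Suc j) (fst ?s 11)"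
    have "fst s'' 10 = fst s 10" "fst s'' 11 = k" using * 3 by auto
    with * 3 k input_ok_01[OF ok] show "fst (fst s'', (snd s'')
       (eval_expr (Plus (Plus (Reg 10) (Mem (Const 1))) (Reg 11)) s'' := eval_expr (Reg 15) s'')) 11 = k \<and>
     (\<forall>r. r \<notin> {11..15} \<longrightarrow> fst (fst s'', (snd s'')
       (eval_expr (Plus (Plus (Reg 10) (Mem (Const 1))) (Reg 11)) s'' := eval_expr (Reg 15) s'')) r = fst s r) \<and>
     (\<forall>a < fst s 10 + m. snd (fst s'', (snd s'')
       (eval_expr (Plus (Plus (Reg 10) (Mem (Const 1))) (Reg 11)) s'' := eval_expr (Reg 15) s'')) a = snd s a) \<and>
     (\<forall>v<m. k \<le> v \<longrightarrow> snd (fst s'', (snd s'')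
       (eval_expr (Plus (Plus (Reg 10) (Mem (Const 1))) (Reg 11)) s'' := eval_expr (Reg 15) s''))
         (fst s 10 + m + v) = walks u (Suc j) v)"
      by (auto simp del: walks.simps)
  qed
next
  case (4 s')
  have ok: "input_ok s'" using assms(1,2) 4 by (auto simp: input_ok_def)
  have "fst s' 10 = fst s 10" using 4 by auto
  with 4 ok input_ok_01[OF ok] assms(2) show ?case
    by (intro wp_SetReg) (auto simp: input_ok_def simp del: walks.simps)
qed (use input_ok_01[OF assms(1)] K in auto)

text \<open>The address of the current layer is only bounded from below by \<open>S\<close>, which
  is what protects the input.\<close>

lemma wp_walk_layers:
  assumes "input_ok s" "fst s 2 = S" "fst s 9 \<le> K"
  shows "wp K walk_layers s (\<lambda>s'. input_ok s' \<and> (\<forall>r. r \<notin> {9..15} \<longrightarrow> fst s' r = fst s r) \<and>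
    S \<le> fst s' 10 \<and> (\<forall>v<m. snd s' (fst s' 10 + v) = walks (fst s 7) (fst s 9) v))"
  unfolding walk_layers_def
proof (intro wp_Seq wp_SetReg, rule wp_For[where I = "\<lambda>k s'. input_ok s' \<and> fst s' 10 = S \<and>
    (\<forall>r. r \<notin> {10..15} \<longrightarrow> fst s' r = fst s r) \<and> (\<forall>v<m. k \<le> v \<longrightarrow> snd s' (S + v) = 0)"], goal_cases)
  case (3 k s')
  then show ?case by (intro wp_SetMem) (auto simp: input_ok_def)
next
  case (4 s')
  show ?case
  proof (intro wp_Seq wp_SetMem, rule wp_For[where I = "\<lambda>k s'. input_ok s' \<and> S \<le> fst s' 10 \<and>
    (\<forall>r. r \<notin> {9..15} \<longrightarrow> fst s' r = fst s r) \<and>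
    (\<forall>v<m. snd s' (fst s' 10 + v) = walks (fst s 7) (fst s 9 - k) v)"], goal_cases)
    case (3 k s'')
    have *: "fst s 9 - k = Suc (fst s 9 - Suc k)" using 3 4 by (simp add: Suc_diff_Suc)
    let ?s = "((fst s'')(9 := k), snd s'')"
    have "wp K walk_layer ?s (\<lambda>s'. input_ok s' \<and> (\<forall>r. r \<notin> {10..15} \<longrightarrow> fst s' r = fst ?s r) \<and>
      S \<le> fst s' 10 \<and> (\<forall>v<m. snd s' (fst s' 10 + v) = walks (fst s 7) (Suc (fst s 9 - Suc k)) v))"
      by (rule wp_walk_layer) (use 3 in \<open>auto simp: input_ok_def\<close>)
    then show ?case
      by (rule wp_mono) (use 3 * in \<open>auto simp del: walks.simps\<close>)
  qed (use 4 assms in \<open>auto simp: input_ok_def\<close>)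
qed (use assms K input_ok_01[OF assms(1)] in \<open>auto simp: input_ok_def\<close>)

lemma wp_walk_check:
  assumes "input_ok s" "fst s 2 = S" "fst s 9 \<le> K" "fst s 8 < m"
  shows "wp K walk_check s (\<lambda>s'. input_ok s' \<and> (\<forall>r. r \<notin> {0, 9, 10, 11, 12, 13, 14, 15} \<longrightarrow> fst s' r = fst s r) \<and>
    fst s' 0 = (if walks (fst s 7) (fst s 9) (fst s 8) \<noteq> 0 then fst s 0 else 0))"
  unfolding walk_check_def
proof (intro wp_Seq, rule wp_mono[OF wp_walk_layers], goal_cases)
  case (4 s')
  then have "fst s' 8 = fst s 8" by auto
  with 4 assms(4) show ?case
    by (intro wp_IfNonzero wp_Skip wp_SetReg) (auto simp: input_ok_def)
qed (use assms in auto)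

definition ready :: "store \<Rightarrow> bool" where
  "ready s \<longleftrightarrow> input_ok s \<and> fst s 1 = 2 + m * m \<and> fst s 2 = S"

text \<open>\<open>ps\<close> are the counters set by outer loops, \<open>rs\<close> those still to
  be run through. The body either keeps or clears the flag, so the loops form the conjunction of
  \<open>\<phi>\<close> over all values of \<open>rs\<close>. Registers 0, 1 and 2 are barred as
  counters because they hold the flag and the two addresses fixed by \<open>ready\<close>.\<close>

lemma wp_foralls:
  assumes body: "\<And>s. ready s \<Longrightarrow> set (map (fst s) qs) \<subseteq> {..n} \<Longrightarrow>
      wp K p s (\<lambda>s'. ready s' \<and> (\<forall>r\<in>set qs. fst s' r = fst s r) \<and>
        fst s' 0 = (if \<phi> (map (fst s) qs) then fst s 0 else 0))"
    and "distinct qs" "{0, 1, 2} \<inter> set qs = {}"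
  shows "ps @ rs = qs \<Longrightarrow> ready s \<Longrightarrow> set (map (fst s) ps) \<subseteq> {..n} \<Longrightarrow>
    wp K (foralls rs p) s (\<lambda>s'. ready s' \<and> (\<forall>r\<in>set ps. fst s' r = fst s r) \<and>
      fst s' 0 = (if \<forall>xs. length xs = length rs \<and> set xs \<subseteq> {..n} \<longrightarrow> \<phi> (map (fst s) ps @ xs)
        then fst s 0 else 0))"
proof (induction rs arbitrary: ps s)
  case Nil
  then show ?case using body[of s] by simp
next
  case (Cons r rs)
  define P where "P x \<longleftrightarrow> (\<forall>xs. length xs = length rs \<and> set xs \<subseteq> {..n} \<longrightarrow> \<phi> (map (fst s) ps @ x # xs))" for x
  have r: "r \<notin> set ps" "r \<noteq> 0" "r \<noteq> 1" "r \<noteq> 2" "\<forall>q\<in>set ps. q \<noteq> 0 \<and> q \<noteq> r"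
    using assms(2,3) Cons.prems(1) by auto
  have n: "snd s 0 = n" using Cons.prems(2) input_ok_01 by (simp add: ready_def)
  have all: "(\<forall>xs. length xs = length (r # rs) \<and> set xs \<subseteq> {..n} \<longrightarrow> \<phi> (map (fst s) ps @ xs)) \<longleftrightarrow>
      (\<forall>x\<le>n. P x)"
    by (force simp: length_Suc_conv P_def)
  show ?case
    unfolding foralls.simps all
  proof (rule wp_For[where I = "\<lambda>k s'. ready s' \<and> (\<forall>r\<in>set ps. fst s' r = fst s r) \<and>
      fst s' 0 = (if \<forall>x\<le>n. k \<le> x \<longrightarrow> P x then fst s 0 else 0)"], goal_cases)
    case (3 k s')
    let ?s = "((fst s')(r := k), snd s')"
    have k: "k \<le> n" using 3 n by simp
    have ps: "map (fst ?s) (ps @ [r]) = map (fst s) ps @ [k]" using 3 r by auto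
    have "ready ?s" using 3 r by (auto simp: ready_def input_ok_def)
    then have "wp K (foralls rs p) ?s (\<lambda>s'. ready s' \<and> (\<forall>r\<in>set (ps @ [r]). fst s' r = fst ?s r) \<and>
      fst s' 0 = (if \<forall>xs. length xs = length rs \<and> set xs \<subseteq> {..n} \<longrightarrow> \<phi> (map (fst ?s) (ps @ [r]) @ xs)
        then fst ?s 0 else 0))"
      by (intro Cons.IH) (use Cons.prems 3 k r in auto)
    then have *: "wp K (foralls rs p) ?s (\<lambda>s'. ready s' \<and> (\<forall>r\<in>set (ps @ [r]). fst s' r = fst ?s r) \<and>
      fst s' 0 = (if P k then fst ?s 0 else 0))"
      unfolding ps P_def by simp
    \<comment> \<open>The part of the conjunction tested so far, the counter having come down from
      \<open>n\<close>.\<close>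
    define A where "A i \<longleftrightarrow> (\<forall>x\<le>n. i \<le> x \<longrightarrow> P x)" for i
    have "A k \<longleftrightarrow> P k \<and> A (Suc k)"
      unfolding A_def using k by (auto simp: Suc_le_eq order_le_less)
    moreover have "fst s' 0 = (if A (Suc k) then fst s 0 else 0)" using 3(3) unfolding A_def by blast
    moreover have "fst ?s 0 = fst s' 0" using r(2) by simp
    ultimately have flag: "(if P k then fst ?s 0 else 0) = (if A k then fst s 0 else 0)"
      by (metis (no_types))
    have "\<forall>q\<in>set ps. fst s' q = fst s q" using 3(3) by blast
    then have "\<forall>q\<in>set ps. fst ?s q = fst s q" using r(5) by simp
    with * show ?case
      unfolding flag A_def[symmetric] by (elim wp_mono) simp
  next
    case (4 s')
    then show ?case by simp
  qed (use Cons.prems n K r in \<open>auto simp: ready_def input_ok_def\<close>)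
qed

section \<open>Testing a pair of boundary points\<close>

definition on_boundary :: "nat list \<Rightarrow> bool" where
  "on_boundary xs \<longleftrightarrow> 0 \<in> set xs \<or> n \<in> set xs"

definition entry :: "nat list \<Rightarrow> nat" where
  "entry xs = M (2 + m * m + horner_sum (\<lambda>x. x) (Suc n) xs)"

text \<open>Bounds the number of walk layers by \<open>d * n\<close>, and so by
  \<open>K\<close>.\<close>

lemma dist_nat_le: "set xs \<subseteq> {..n} \<Longrightarrow> set ys \<subseteq> {..n} \<Longrightarrow> dist_nat xs ys \<le> length xs * n"
proof (induction xs ys rule: list_induct2')
  case (4 x xs y ys)
  then have "dist_nat xs ys \<le> length xs * n" "(x - y) + (y - x) \<le> n" by auto
  then show ?case by (simp add: dist_nat_def)
qed (simp_all add: dist_nat_def)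

lemma eval_boundary_expr:
  assumes "input_ok s" "set (map (fst s) rs) \<subseteq> {..n}"
  shows "eval_expr (boundary_expr rs) s \<noteq> 0 \<longleftrightarrow> on_boundary (map (fst s) rs)"
  using assms(2)
proof (induction rs)
  case (Cons r rs)
  have "eval_expr (boundary_expr (r # rs)) s
      = (1 - fst s r) + (1 - (n - fst s r)) + eval_expr (boundary_expr rs) s"
    using input_ok_01(1)[OF assms(1)] by (simp add: boundary_expr_def sum_expr_def)
  moreover have "on_boundary (map (fst s) (r # rs)) \<longleftrightarrow>
      fst s r = 0 \<or> fst s r = n \<or> on_boundary (map (fst s) rs)"
    by (auto simp: on_boundary_def)
  moreover have "(1 - fst s r) + (1 - (n - fst s r)) \<noteq> 0 \<longleftrightarrow> fst s r = 0 \<or> fst s r = n"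
    using Cons.prems by simp arith
  moreover have "eval_expr (boundary_expr rs) s \<noteq> 0 \<longleftrightarrow> on_boundary (map (fst s) rs)"
    by (rule Cons.IH) (use Cons.prems in simp)
  ultimately show ?case by (simp only: add_eq_0_iff_both_eq_0) blast
qed (simp add: boundary_expr_def sum_expr_def on_boundary_def)

lemma eval_dist_expr:
  "eval_expr (dist_expr rs rs') s = dist_nat (map (fst s) rs) (map (fst s) rs')"
  by (induction rs rs' rule: list_induct2') (auto simp: dist_expr_def eval_sum_expr dist_nat_def)

lemma entry_eq:
  assumes "input_ok s" "length xs = d" "set xs \<subseteq> {..n}"
  shows "snd s (2 + m * m + horner_sum (\<lambda>x. x) (Suc n) xs) = entry xs"
proof -
  have "2 + m * m + horner_sum (\<lambda>x. x) (Suc n) xs < S"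
    unfolding S using horner_less[OF assms(3)] assms(2) by simp
  with assms(1) show ?thesis unfolding input_ok_def entry_def by blast
qed

text \<open>Registers 4 to 6 belong to \<open>horner\<close>, 7 and 8 to the fetched vertices and 9
  to 15 to the walk count, so the coordinates from 16 on survive. The assumption
  \<open>entry\<close> ensures that the vertex looked up in the last layer is one of its
  \<open>m\<close> cells.\<close>

lemma wp_pair_check:
  assumes "ready s" "length rs = d" "length rs' = d" "set rs \<subseteq> {16..}" "set rs' \<subseteq> {16..}"
    and le: "set (map (fst s) rs) \<subseteq> {..n}" "set (map (fst s) rs') \<subseteq> {..n}"
    and entry: "\<And>xs. length xs = d \<Longrightarrow> set xs \<subseteq> {..n} \<Longrightarrow> on_boundary xs \<Longrightarrow> entry xs < m"
  shows "wp K (pair_check rs rs') s (\<lambda>s'. ready s' \<and> (\<forall>r\<in>set (rs @ rs'). fst s' r = fst s r) \<and>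
    fst s' 0 = (if on_boundary (map (fst s) rs) \<and> on_boundary (map (fst s) rs') \<longrightarrow>
      walks (entry (map (fst s) rs')) (dist_nat (map (fst s) rs) (map (fst s) rs')) (entry (map (fst s) rs)) \<noteq> 0
      then fst s 0 else 0))"
proof -
  let ?xs = "map (fst s) rs" and ?ys = "map (fst s) rs'"
  have ok: "input_ok s" using assms(1) by (simp add: ready_def)
  have bd: "eval_expr (boundary_expr rs) s \<noteq> 0 \<longleftrightarrow> on_boundary ?xs"
    "eval_expr (boundary_expr rs') s \<noteq> 0 \<longleftrightarrow> on_boundary ?ys"
    using eval_boundary_expr[OF ok] le by auto
  have horner: "wp K (horner (map Reg qs)) s' (\<lambda>s''. (\<forall>r. r \<notin> {4,5,6} \<longrightarrow> fst s'' r = fst s' r) \<and>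
      snd s'' = snd s' \<and> fst s'' 4 = horner_sum (\<lambda>x. x) (Suc n) (map (fst s) qs))"
    if "set qs \<subseteq> {16..}" "snd s' = snd s" "\<And>r. r \<ge> 16 \<Longrightarrow> fst s' r = fst s r" for qs s'
  proof -
    have vals: "map (\<lambda>e. eval_expr e s') (map Reg qs) = map (fst s) qs" using that by auto
    have n: "snd s' 0 = n" using input_ok_01[OF ok] that by simp
    have "wp K (horner (map Reg qs)) s' (\<lambda>s''. (\<forall>r. r \<notin> {4,5,6} \<longrightarrow> fst s'' r = fst s' r) \<and>
      snd s'' = snd s' \<and>
      fst s'' 4 = horner_sum (\<lambda>x. x) (Suc (snd s' 0)) (map (\<lambda>e. eval_expr e s') (map Reg qs)))"
      by (rule wp_horner) (use that K input_ok_01[OF ok] in \<open>force+\<close>)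
    then show ?thesis unfolding vals n .
  qed
  show ?thesis
    unfolding pair_check_def
  proof (intro wp_IfNonzero wp_Skip)
    assume "eval_expr (boundary_expr rs) s \<noteq> 0" "eval_expr (boundary_expr rs') s \<noteq> 0"
    then have b: "on_boundary ?xs" "on_boundary ?ys" using bd by simp_all
    show "wp K (Seq (horner (map Reg rs)) (Seq (SetReg 8 (Mem (Plus (Reg 1) (Reg 4))))
     (Seq (horner (map Reg rs')) (Seq (SetReg 7 (Mem (Plus (Reg 1) (Reg 4))))
     (Seq (SetReg 9 (dist_expr rs rs')) walk_check))))) s
     (\<lambda>s'. ready s' \<and> (\<forall>r\<in>set (rs @ rs'). fst s' r = fst s r) \<and>
    fst s' 0 = (if on_boundary ?xs \<and> on_boundary ?ys \<longrightarrow>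
      walks (entry ?ys) (dist_nat ?xs ?ys) (entry ?xs) \<noteq> 0 then fst s 0 else 0))"
    proof (intro wp_Seq, rule wp_mono[OF horner[OF assms(4) refl refl]], intro wp_Seq wp_SetReg, elim conjE)
      fix s1
      assume s1: "\<forall>r. r \<notin> {4,5,6} \<longrightarrow> fst s1 r = fst s r" "snd s1 = snd s"
        "fst s1 4 = horner_sum (\<lambda>x. x) (Suc n) ?xs"
      have e1: "eval_expr (Mem (Plus (Reg 1) (Reg 4))) s1 = entry ?xs"
        using s1 assms(1,2) le(1) entry_eq[OF ok, of ?xs] by (simp add: ready_def)
      show "wp K (horner (map Reg rs')) ((fst s1)(8 := eval_expr (Mem (Plus (Reg 1) (Reg 4))) s1), snd s1)
        (\<lambda>s'. wp K (Seq (SetReg 7 (Mem (Plus (Reg 1) (Reg 4))))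
           (Seq (SetReg 9 (dist_expr rs rs')) walk_check)) s'
          (\<lambda>s'. ready s' \<and> (\<forall>r\<in>set (rs @ rs'). fst s' r = fst s r) \<and>
            fst s' 0 = (if on_boundary ?xs \<and> on_boundary ?ys \<longrightarrow>
              walks (entry ?ys) (dist_nat ?xs ?ys) (entry ?xs) \<noteq> 0 then fst s 0 else 0)))"
        unfolding e1
      proof (rule wp_mono[OF horner[OF assms(5)]], use s1 in simp, use s1 in simp,
          intro wp_Seq wp_SetReg, elim conjE)
        fix s2
        assume s2: "\<forall>r. r \<notin> {4,5,6} \<longrightarrow> fst s2 r = fst ((fst s1)(8 := entry ?xs), snd s1) r"
          "snd s2 = snd ((fst s1)(8 := entry ?xs), snd s1)" "fst s2 4 = horner_sum (\<lambda>x. x) (Suc n) ?ys"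
        have e2: "eval_expr (Mem (Plus (Reg 1) (Reg 4))) s2 = entry ?ys"
          using s1 s2 assms(1,3) le(2) entry_eq[OF ok, of ?ys] by (simp add: ready_def)
        define s3 where "s3 = ((fst s2)(7 := entry ?ys), snd s2)"
        have "map (fst s3) rs = ?xs" "map (fst s3) rs' = ?ys"
          using s1 s2 assms(4,5) by (auto simp: s3_def)
        then have e3: "eval_expr (dist_expr rs rs') s3 = dist_nat ?xs ?ys"
          by (simp only: eval_dist_expr)
        define s4 where "s4 = ((fst s3)(9 := dist_nat ?xs ?ys), snd s3)"
        have s4: "input_ok s4" "fst s4 0 = fst s 0" "fst s4 1 = fst s 1" "fst s4 2 = fst s 2"
          "fst s4 7 = entry ?ys" "fst s4 8 = entry ?xs" "fst s4 9 = dist_nat ?xs ?ys"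
          "\<And>r. r \<ge> 16 \<Longrightarrow> fst s4 r = fst s r"
          using s1 s2 ok by (auto simp: s3_def s4_def input_ok_def)
        have "dist_nat ?xs ?ys \<le> K" using dist_nat_le[OF le] assms(2) K by simp
        moreover have "entry ?xs < m" by (rule entry) (use le assms b in auto)
        ultimately have "wp K walk_check s4 (\<lambda>s'. input_ok s' \<and>
            (\<forall>r. r \<notin> {0, 9, 10, 11, 12, 13, 14, 15} \<longrightarrow> fst s' r = fst s4 r) \<and>
            fst s' 0 = (if walks (fst s4 7) (fst s4 9) (fst s4 8) \<noteq> 0 then fst s4 0 else 0))"
          by (intro wp_walk_check) (use s4 assms(1) in \<open>auto simp: ready_def\<close>)
        then have "wp K walk_check s4 (\<lambda>s'. ready s' \<and> (\<forall>r\<in>set (rs @ rs'). fst s' r = fst s r) \<and>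
            fst s' 0 = (if on_boundary ?xs \<and> on_boundary ?ys \<longrightarrow>
              walks (entry ?ys) (dist_nat ?xs ?ys) (entry ?xs) \<noteq> 0 then fst s 0 else 0))"
        proof (rule wp_mono, elim conjE)
          fix s' assume *: "input_ok s'" "\<forall>r. r \<notin> {0, 9, 10, 11, 12, 13, 14, 15} \<longrightarrow> fst s' r = fst s4 r"
            "fst s' 0 = (if walks (fst s4 7) (fst s4 9) (fst s4 8) \<noteq> 0 then fst s4 0 else 0)"
          have "ready s'" using * s4 assms(1) by (auto simp: ready_def)
          moreover have "fst s' r = fst s r" if "r \<in> set (rs @ rs')" for r
          proof -
            have "r \<ge> 16" using that assms(4,5) by auto
            then show ?thesis using * s4 by auto
          qed
          ultimately show "ready s' \<and> (\<forall>r\<in>set (rs @ rs'). fst s' r = fst s r) \<and>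
            fst s' 0 = (if on_boundary ?xs \<and> on_boundary ?ys \<longrightarrow>
              walks (entry ?ys) (dist_nat ?xs ?ys) (entry ?xs) \<noteq> 0 then fst s 0 else 0)"
            using *(3) s4 b by simp
        qed
        then show "wp K walk_check
            ((fst ((fst s2)(7 := eval_expr (Mem (Plus (Reg 1) (Reg 4))) s2), snd s2))
             (9 := eval_expr (dist_expr rs rs') ((fst s2)(7 := eval_expr (Mem (Plus (Reg 1) (Reg 4))) s2), snd s2)),
             snd ((fst s2)(7 := eval_expr (Mem (Plus (Reg 1) (Reg 4))) s2), snd s2))
            (\<lambda>s'. ready s' \<and> (\<forall>r\<in>set (rs @ rs'). fst s' r = fst s r) \<and>
            fst s' 0 = (if on_boundary ?xs \<and> on_boundary ?ys \<longrightarrow>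
              walks (entry ?ys) (dist_nat ?xs ?ys) (entry ?xs) \<noteq> 0 then fst s 0 else 0))"
          unfolding e2 s3_def[symmetric] e3 s4_def[symmetric] .
      qed
    qed
  qed (use assms(1) bd in auto)
qed

lemma wp_setup:
  assumes "input_ok s"
  shows "wp K (setup_prog d) s (\<lambda>s'. ready s' \<and> fst s' 0 = 1)"
  unfolding setup_prog_def
proof (intro wp_Seq wp_SetReg, rule wp_For[where I = "\<lambda>k s'. snd s' = snd s \<and>
    fst s' 1 = 2 + (m - k) * m"], goal_cases)
  case (3 k s')
  then have "m - k = Suc (m - Suc k)" using input_ok_01[OF assms] by (simp add: Suc_diff_Suc)
  with 3 input_ok_01[OF assms] show ?case by (intro wp_SetReg) auto
next
  case (4 s')
  have n: "snd s' 0 = n" using 4 input_ok_01[OF assms] by simp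
  have "wp K (horner (replicate d (Mem (Const 0)))) s' (\<lambda>s''. (\<forall>r. r \<notin> {4,5,6} \<longrightarrow> fst s'' r = fst s' r) \<and>
      snd s'' = snd s' \<and>
      fst s'' 4 = horner_sum (\<lambda>x. x) (Suc (snd s' 0)) (map (\<lambda>e. eval_expr e s') (replicate d (Mem (Const 0)))))"
    by (rule wp_horner) (use n K in auto)
  then show ?case
  proof (intro wp_Seq, elim wp_mono, intro wp_Seq wp_SetReg, goal_cases)
    case (1 s'')
    have "map (\<lambda>e. eval_expr e s') (replicate d (Mem (Const 0))) = replicate d n" using n by simp
    with 1 have h: "Suc (fst s'' 4) = Suc n ^ d" using n horner_replicate by metis
    have *: "fst s'' 1 = 2 + m * m" "snd s'' = snd s" using 1 4 by simp_all
    with h have "fst s'' 1 + fst s'' 4 + 1 = S" unfolding S by linarith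
    then have "eval_expr (Plus (Plus (Reg 1) (Reg 4)) (Const 1)) s'' = S" by simp
    then show ?case using assms * unfolding ready_def input_ok_def by simp
  qed
qed (use assms K input_ok_01[OF assms] in auto)

lemma wp_hole_filling_prog:
  assumes "input_ok s"
    and entry: "\<And>xs. length xs = d \<Longrightarrow> set xs \<subseteq> {..n} \<Longrightarrow> on_boundary xs \<Longrightarrow> entry xs < m"
  shows "wp K (hole_filling_prog d) s (\<lambda>s'. fst s' 0 = of_bool
    (\<forall>xs ys. length xs = d \<and> length ys = d \<and> set xs \<subseteq> {..n} \<and> set ys \<subseteq> {..n} \<and>
       on_boundary xs \<and> on_boundary ys \<longrightarrow> walks (entry ys) (dist_nat xs ys) (entry xs) \<noteq> 0))"
    (is "wp _ _ _ (\<lambda>s'. _ = of_bool ?C)")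
  unfolding hole_filling_prog_def
proof (intro wp_Seq, rule wp_mono[OF wp_setup[OF assms(1)]], elim conjE)
  fix s1 assume s1: "ready s1" "fst s1 0 = 1"
  let ?rs = "[16..<16 + d]" and ?rs' = "[16 + d..<16 + d + d]"
  \<comment> \<open>\<open>wp_foralls\<close> delivers the values of all \<open>2 * d\<close>
    counters as one list; its halves are the two points.\<close>
  define \<phi> where "\<phi> zs \<longleftrightarrow> (on_boundary (take d zs) \<and> on_boundary (drop d zs) \<longrightarrow>
    walks (entry (drop d zs)) (dist_nat (take d zs) (drop d zs)) (entry (take d zs)) \<noteq> 0)" for zs
  have "wp K (foralls (?rs @ ?rs') (pair_check ?rs ?rs')) s1 (\<lambda>s'. ready s' \<and>
      (\<forall>r\<in>set []. fst s' r = fst s1 r) \<and> fst s' 0 = (if \<forall>zs. length zs = length (?rs @ ?rs') \<and>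
        set zs \<subseteq> {..n} \<longrightarrow> \<phi> (map (fst s1) [] @ zs) then fst s1 0 else 0))"
  proof (rule wp_foralls[where qs = "?rs @ ?rs'"])
    fix s assume s: "ready s" "set (map (fst s) (?rs @ ?rs')) \<subseteq> {..n}"
    have "wp K (pair_check ?rs ?rs') s (\<lambda>s'. ready s' \<and> (\<forall>r\<in>set (?rs @ ?rs'). fst s' r = fst s r) \<and>
    fst s' 0 = (if on_boundary (map (fst s) ?rs) \<and> on_boundary (map (fst s) ?rs') \<longrightarrow>
      walks (entry (map (fst s) ?rs')) (dist_nat (map (fst s) ?rs) (map (fst s) ?rs')) (entry (map (fst s) ?rs)) \<noteq> 0
      then fst s 0 else 0))"
      by (rule wp_pair_check) (use s entry in auto)
    moreover have "take d (map (fst s) (?rs @ ?rs')) = map (fst s) ?rs"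
      "drop d (map (fst s) (?rs @ ?rs')) = map (fst s) ?rs'" by simp_all
    ultimately show "wp K (pair_check ?rs ?rs') s (\<lambda>s'. ready s' \<and>
      (\<forall>r\<in>set (?rs @ ?rs'). fst s' r = fst s r) \<and>
      fst s' 0 = (if \<phi> (map (fst s) (?rs @ ?rs')) then fst s 0 else 0))"
      unfolding \<phi>_def by presburger
  qed (use s1 in auto)
  moreover have "(\<forall>zs. length zs = length (?rs @ ?rs') \<and> set zs \<subseteq> {..n} \<longrightarrow> \<phi> (map (fst s1) [] @ zs)) \<longleftrightarrow> ?C"
  proof
    assume *: "\<forall>zs. length zs = length (?rs @ ?rs') \<and> set zs \<subseteq> {..n} \<longrightarrow> \<phi> (map (fst s1) [] @ zs)"
    show ?C
    proof (intro allI impI)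
      fix xs ys
      assume "length xs = d \<and> length ys = d \<and> set xs \<subseteq> {..n} \<and> set ys \<subseteq> {..n} \<and>
       on_boundary xs \<and> on_boundary ys"
      then show "walks (entry ys) (dist_nat xs ys) (entry xs) \<noteq> 0"
        using *[rule_format, of "xs @ ys"] by (simp add: \<phi>_def)
    qed
  next
    assume C: ?C
    show "\<forall>zs. length zs = length (?rs @ ?rs') \<and> set zs \<subseteq> {..n} \<longrightarrow> \<phi> (map (fst s1) [] @ zs)"
    proof (intro allI impI)
      fix zs assume "length zs = length (?rs @ ?rs') \<and> set zs \<subseteq> {..n}"
      then have "length (take d zs) = d" "length (drop d zs) = d" "set (take d zs) \<subseteq> {..n}"
        "set (drop d zs) \<subseteq> {..n}" using set_take_subset set_drop_subset by force+
      then show "\<phi> (map (fst s1) [] @ zs)" using C unfolding \<phi>_def by simp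
    qed
  qed
  ultimately have "wp K (foralls (?rs @ ?rs') (pair_check ?rs ?rs')) s1 (\<lambda>s'. ready s' \<and>
      (\<forall>r\<in>set []. fst s' r = fst s1 r) \<and> fst s' 0 = (if ?C then fst s1 0 else 0))"
    by (simp only:)
  then show "wp K (foralls (?rs @ ?rs') (pair_check ?rs ?rs')) s1 (\<lambda>s'. fst s' 0 = of_bool ?C)"
    by (rule wp_mono) (simp only: s1(2) of_bool_def)
qed

end

section \<open>Reading the input\<close>

lemma concat_nth_uniform:
  assumes "\<And>xs. xs \<in> set xss \<Longrightarrow> length xs = k" "i < length xss" "j < k"
  shows "i * k + j < length (concat xss) \<and> concat xss ! (i * k + j) = xss ! i ! j"
  using assms
proof (induction xss arbitrary: i)
  case (Cons xs xss)
  have len: "length xs = k" using Cons.prems(1) by simp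
  show ?case
  proof (cases i)
    case (Suc i')
    have "i' * k + j < length (concat xss) \<and> concat xss ! (i' * k + j) = xss ! i' ! j"
      by (rule Cons.IH) (use Cons.prems Suc in auto)
    then show ?thesis using len Suc by (simp add: nth_append add.assoc)
  qed (use len Cons.prems in \<open>simp add: nth_append\<close>)
qed simp

lemma length_n_lists_upto: "length (List.n_lists d [0..int n]) = Suc n ^ d"
proof -
  have "nat (int n + 1) = Suc n" by simp
  then show ?thesis by (simp add: length_n_lists)
qed

text \<open>\<open>List.n_lists\<close> varies the head fastest, so the head is the least
  significant digit, as in \<open>horner_sum\<close>.\<close>

lemma n_lists_nth_horner:
  assumes "set xs \<subseteq> {..n}"
  shows "List.n_lists (length xs) [0..int n] ! horner_sum (\<lambda>x. x) (Suc n) xs = map int xs"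
  using assms
proof (induction xs)
  case (Cons x xs)
  let ?h = "horner_sum (\<lambda>x. x) (Suc n) xs"
  let ?yss = "List.n_lists (length xs) [0..int n]"
  have h: "?h < length ?yss" using Cons.prems horner_less[of xs n] by (simp add: length_n_lists_upto)
  have x: "x < Suc n" using Cons.prems by simp
  have "concat (map (\<lambda>ys. map (\<lambda>y. y # ys) [0..int n]) ?yss) ! (?h * Suc n + x)
      = map (\<lambda>ys. map (\<lambda>y. y # ys) [0..int n]) ?yss ! ?h ! x"
    by (rule concat_nth_uniform[THEN conjunct2]) (use h x in auto)
  also have "\<dots> = int x # map int xs"
  proof -
    have "[0..int n] ! x = int x" using x nth_upto[of 0 x "int n"] by simp
    with h x Cons show ?thesis by simp
  qed
  finally show ?case by (simp add: algebra_simps)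
qed simp

lemma l1_map_int: "length xs = length ys \<Longrightarrow> l1 (map int xs) (map int ys) = dist_nat xs ys"
  unfolding dist_nat_def
proof (induction xs ys rule: list_induct2)
  case (Cons x xs y ys)
  have "nat \<bar>int x - int y\<bar> = (x - y) + (y - x)" by simp
  with Cons show ?case by (simp add: l1_def sum.lessThan_Suc_shift del: sum.lessThan_Suc)
qed (simp add: l1_def)

text \<open>Bridges the natural coordinates held in registers and the integer coordinates of the
  lattice.\<close>

lemma verts_box_nat: "verts (box d n) = map int ` {xs. length xs = d \<and> set xs \<subseteq> {..n}}"
proof (intro equalityI subsetI)
  fix x assume x: "x \<in> verts (box d n)"
  then have "x = map int (map nat x)" by (auto simp: verts_box list_eq_iff_nth_eq subset_iff)
  moreover have "set (map nat x) \<subseteq> {..n}" "length (map nat x) = d"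
    using x by (fastforce simp: verts_box)+
  ultimately show "x \<in> map int ` {xs. length xs = d \<and> set xs \<subseteq> {..n}}" by blast
qed (fastforce simp: verts_box)

lemma mem_verts_box_boundary_iff:
  "length xs = d \<Longrightarrow> set xs \<subseteq> {..n} \<Longrightarrow>
    map int xs \<in> verts (box_boundary d n) \<longleftrightarrow> 0 \<in> set xs \<or> n \<in> set xs"
  unfolding verts_box_boundary verts_box_nat by (auto simp: in_set_conv_nth)

context
  fixes d n m :: nat and H :: "nat pair_pre_digraph" and f :: "int list \<Rightarrow> nat" and M :: "nat \<Rightarrow> nat"
  assumes H: "pair_wf_digraph H" "pverts H = {..<m}"
  defines "M \<equiv> snd (initial_store (encode_instance d n H f))"
begin

lemma encode_instance_eq:
  "encode_instance d n H f = [n, m] @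
     concat (map (\<lambda>i. map (\<lambda>j. of_bool ((i, j) \<in> parcs H)) [0..<m]) [0..<m]) @
     map (\<lambda>x. if x \<in> verts (box_boundary d n) then f x else 0) (List.n_lists d [0..int n])"
  by (simp add: encode_instance_def H(2))

lemma length_adjacency:
  "length (concat (map (\<lambda>i. map (\<lambda>j. of_bool ((i, j) \<in> parcs H)) [0..<m]) [0..<m]) :: nat list) = m * m"
  by (simp add: length_concat comp_def sum_list_triv)

lemma memory_0_1: "M 0 = n" "M 1 = m"
  by (simp_all add: M_def initial_store_def encode_instance_eq)

lemma memory_adjacency:
  assumes "w < m" "v < m" shows "M (2 + w * m + v) = of_bool ((w, v) \<in> parcs H)"
proof -
  let ?A = "map (\<lambda>i. map (\<lambda>j. of_bool ((i, j) \<in> parcs H)) [0..<m]) [0..<m] :: nat list list"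
  have "w * m + v < length (concat ?A) \<and> concat ?A ! (w * m + v) = ?A ! w ! v"
    by (rule concat_nth_uniform) (use assms in auto)
  then show ?thesis
    using assms by (simp add: M_def initial_store_def encode_instance_eq nth_append)
qed

lemma memory_table:
  assumes "length xs = d" "set xs \<subseteq> {..n}" "map int xs \<in> verts (box_boundary d n)"
  shows "M (2 + m * m + horner_sum (\<lambda>x. x) (Suc n) xs) = f (map int xs)"
proof -
  have "horner_sum (\<lambda>x. x) (Suc n) xs < length (List.n_lists d [0..int n])"
    using horner_less[OF assms(2)] assms(1) by (simp add: length_n_lists_upto)
  then show ?thesis
    using assms n_lists_nth_horner[OF assms(2)] length_adjacency
    by (simp add: M_def initial_store_def encode_instance_eq nth_append)
qed

end

section \<open>From walk counts to the decision\<close>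

text \<open>A sum of natural numbers vanishes only if all its terms do, so the recursion for counts
  turns into that for existence.\<close>

lemma (in machine_input) walks_iff:
  assumes H: "pair_wf_digraph H" "pverts H = {..<m}"
    and adj: "\<And>w v. w < m \<Longrightarrow> v < m \<Longrightarrow> M (2 + w * m + v) = of_bool ((w, v) \<in> parcs H)"
    and "w < m"
  shows "walks u j w \<noteq> 0 \<longleftrightarrow> (w, u) \<in> parcs H ^^ j"
  using assms(4)
proof (induction j arbitrary: w)
  case (Suc j)
  interpret pair_wf_digraph H by fact
  have "walks u (Suc j) w \<noteq> 0 \<longleftrightarrow> (\<exists>v<m. M (2 + w * m + v) \<noteq> 0 \<and> walks u j v \<noteq> 0)"
    by auto
  also have "\<dots> \<longleftrightarrow> (\<exists>v<m. (w, v) \<in> parcs H \<and> (v, u) \<in> parcs H ^^ j)"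
    using Suc.IH adj[OF Suc.prems] by (metis of_bool_eq_0_iff)
  also have "\<dots> \<longleftrightarrow> (w, u) \<in> parcs H ^^ Suc j"
    using in_arcsD2 H(2) by (metis lessThan_iff relpow_Suc_D2 relpow_Suc_I2)
  finally show ?case .
qed simp

lemma hole_filling_prog_correct:
  assumes "d \<ge> 1" "n \<ge> 1" and H: "pair_sym_digraph H" "pverts H = {..<m}" "bipartite_helly2 (2 * d) H"
    and f: "f \<in> Hom (box_boundary d n) H"
  shows "answers_within (hole_filling_prog d) (encode_instance d n H f)
    (\<exists>g \<in> Hom (box d n) H. \<forall>x \<in> verts (box_boundary d n). g x = f x)
    (time_bound (Suc d * (n + m) + 1) (hole_filling_prog d))"
proof -
  interpret H: pair_sym_digraph H by (fact H)
  have wf: "pair_wf_digraph H" by unfold_locales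
  define M where "M = snd (initial_store (encode_instance d n H f))"
  \<comment> \<open>\<open>K\<close> dominates every loop count: \<open>m\<close>,
    \<open>n + 1\<close> and the length of a walk, which is at most \<open>d * n\<close>.\<close>
  define K where "K = Suc d * (n + m) + 1"
  define S where "S = 2 + m * m + Suc n ^ d"
  note mem = memory_0_1[OF wf H(2), of d n f, folded M_def]
    memory_adjacency[OF wf H(2), of _ _ d n f, folded M_def]
    memory_table[OF wf H(2), of _ d n f, folded M_def]
  interpret machine_input n m d K S M
    by unfold_locales (use mem(1,2) in \<open>simp_all add: K_def S_def add_mult_distrib2\<close>)
  have bd: "on_boundary xs \<longleftrightarrow> map int xs \<in> verts (box_boundary d n)"
    if "length xs = d" "set xs \<subseteq> {..n}" for xs
    using mem_verts_box_boundary_iff[OF that] by (simp add: on_boundary_def)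
  have entry: "entry xs = f (map int xs)" "entry xs < m"
    if "length xs = d" "set xs \<subseteq> {..n}" "on_boundary xs" for xs
  proof -
    have *: "map int xs \<in> verts (box_boundary d n)" using bd that by simp
    then show e: "entry xs = f (map int xs)" using mem(4) that by (simp add: entry_def)
    have "f (map int xs) \<in> pverts H" using f * by (auto simp: Hom_def)
    then show "entry xs < m" using e H(2) by simp
  qed
  have walk: "walks (entry ys) (dist_nat xs ys) (entry xs) \<noteq> 0 \<longleftrightarrow>
      (f (map int xs), f (map int ys)) \<in> parcs H ^^ l1 (map int xs) (map int ys)"
    if "length xs = d" "set xs \<subseteq> {..n}" "on_boundary xs"
      "length ys = d" "set ys \<subseteq> {..n}" "on_boundary ys" for xs ys
    using walks_iff[OF wf H(2) mem(3) entry(2)[OF that(1-3)]] entry(1) l1_map_int[of xs ys] that by simp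
  have "(\<exists>g \<in> Hom (box d n) H. \<forall>x \<in> verts (box_boundary d n). g x = f x) \<longleftrightarrow>
    (\<forall>xs ys. length xs = d \<and> length ys = d \<and> set xs \<subseteq> {..n} \<and> set ys \<subseteq> {..n} \<and>
       on_boundary xs \<and> on_boundary ys \<longrightarrow> walks (entry ys) (dist_nat xs ys) (entry xs) \<noteq> 0)"
    (is "_ \<longleftrightarrow> ?C")
    unfolding hole_filling_iff[OF assms(1,2) H(1,3)]
  proof
    assume R: "\<forall>x \<in> verts (box_boundary d n). \<forall>y \<in> verts (box_boundary d n).
      (f x, f y) \<in> parcs H ^^ l1 x y"
    show ?C
    proof (intro allI impI, elim conjE)
      fix xs ys
      assume *: "length xs = d" "length ys = d" "set xs \<subseteq> {..n}" "set ys \<subseteq> {..n}"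
        "on_boundary xs" "on_boundary ys"
      then show "walks (entry ys) (dist_nat xs ys) (entry xs) \<noteq> 0"
        unfolding walk[OF *(1,3,5,2,4,6)] using R bd by blast
    qed
  next
    assume C: ?C
    show "\<forall>x \<in> verts (box_boundary d n). \<forall>y \<in> verts (box_boundary d n).
      (f x, f y) \<in> parcs H ^^ l1 x y"
    proof (intro ballI)
      fix x y assume xy: "x \<in> verts (box_boundary d n)" "y \<in> verts (box_boundary d n)"
      then have "x \<in> verts (box d n)" "y \<in> verts (box d n)" by (auto simp: verts_box_boundary)
      then obtain xs ys where *: "x = map int xs" "length xs = d" "set xs \<subseteq> {..n}"
        "y = map int ys" "length ys = d" "set ys \<subseteq> {..n}"
        by (auto simp: verts_box_nat)
      then have "on_boundary xs" "on_boundary ys" using bd xy by auto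
      then show "(f x, f y) \<in> parcs H ^^ l1 x y" using C walk * by blast
    qed
  qed
  moreover have "input_ok (initial_store (encode_instance d n H f))"
    unfolding input_ok_def by (simp add: M_def)
  from wp_hole_filling_prog[OF this entry(2)]
  have "wp K (hole_filling_prog d) (initial_store (encode_instance d n H f))
      (\<lambda>s'. fst s' 0 = of_bool ?C)" .
  ultimately show ?thesis
    unfolding answers_within_def wp_def K_def by presburger
qed

theorem theorem5p2:
  fixes d :: nat
  assumes "d \<ge> 1"
  shows "\<exists>(A :: prog) (q :: nat poly).
    \<forall>(n :: nat) (H :: nat pair_pre_digraph) (f :: int list \<Rightarrow> nat).
      n \<ge> 1 \<longrightarrow>
      pair_graph H \<longrightarrow> connected H \<longrightarrow> pverts H = {..<card (pverts H)} \<longrightarrow>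
      bipartite_helly2 (2 * d) H \<longrightarrow>
      f \<in> Hom (box_boundary d n) H \<longrightarrow>
      answers_within A (encode_instance d n H f)
        (\<exists>g \<in> Hom (box d n) H. \<forall>x \<in> verts (box_boundary d n). g x = f x)
        (poly q (n + card (pverts H)))"
proof -
  obtain q where q: "\<And>K. time_bound K (hole_filling_prog d) = poly q K"
    using time_bound_poly by blast
  \<comment> \<open>\<open>q\<close> bounds the time in terms of \<open>K\<close>; composition with
    the linear polynomial \<open>1 + (d + 1) X\<close> expresses it in terms of the size
    \<open>n + |H|\<close>.\<close>
  have bound: "poly (q \<circ>\<^sub>p [:1, Suc d:]) k = time_bound (Suc d * k + 1) (hole_filling_prog d)" for k
    by (simp add: q poly_pcompose algebra_simps)
  show ?thesis
  proof (intro exI allI impI)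
    fix n :: nat and H :: "nat pair_pre_digraph" and f :: "int list \<Rightarrow> nat"
    assume "n \<ge> 1" "pair_graph H" "pverts H = {..<card (pverts H)}"
      "bipartite_helly2 (2 * d) H" "f \<in> Hom (box_boundary d n) H"
    then show "answers_within (hole_filling_prog d) (encode_instance d n H f)
        (\<exists>g \<in> Hom (box d n) H. \<forall>x \<in> verts (box_boundary d n). g x = f x)
        (poly (q \<circ>\<^sub>p [:1, Suc d:]) (n + card (pverts H)))"
      unfolding bound using assms
      by (intro hole_filling_prog_correct) (auto simp: pair_graph_def pair_pseudo_graph_def)
  qed
qed

end
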